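(* Let $\gamma\in\mathcal{C}(T)$ be an essential curve on the once-punctured torus $T$. Up to a finite set of (non-stable) vertices, the tree $T_\gamma$ is decomposed into finitely many disjoint, forward-complete, maximal stable subtrees.
   Context: $T$ is a once-punctured topological torus. A curve is a free homotopy class of an unoriented closed curve on $T$; $\mathcal{C}(T)$ is the set of curves. $\pi_1(T)$ is free of rank $2$ on $\mathtt{a},\mathtt{b}$, $\mathtt{A}=\mathtt{a}^{-1}$, $\mathtt{B}=\mathtt{b}^{-1}$, and $\mathcal{C}(T)$ is in bijection with conjugacy classes of $\pi_1(T)$ up to inversion. A curve is essential if it is neither null-homotopic nor a power of a loop around the puncture (represented by the commutator of $\mathtt a$ and $\mathtt b$). The mapping classes $L,R\in\mathrm{Mod}(T)$ act on words by $L:\mathtt{a}\mapsto\mathtt{a},\mathtt{b}\mapsto\mathtt{ab}$ and $R:\mathtt{a}\mapsto\mathtt{ab},\mathtt{b}\mapsto\mathtt{b}$; $\langle L,R\rangle_+$ is the free monoid of positive products of $L$ and $R$ (including the identity). $T_\gamma:=\langle L,R\rangle_+\cdot\gamma$, seen as an infinite rooted binary tree: its vertices are indexed by the elements $M\in\langle L,R\rangle_+$, the vertex of $M$ being labelled by the curve $M\gamma$ and having as children the vertices of $LM$ and $RM$ (vertices with the same label are not identified). A word in $\{\mathtt{a},\mathtt{b},\mathtt{A},\mathtt{B}\}$ is monotone if it uses only letters of $\{\mathtt a,\mathtt b\}$ or only letters of $\{\mathtt A,\mathtt B\}$. Put $\mathtt{z}:=\mathtt{aBAb}$. A curve is stable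 if one of its representatives in $\pi_1(T)$ can be written as $\prod_{i=1}^n \mathtt{z}^{e_i}w_i$, with $e_i\in\mathbb{Z}$, all $e_i\neq0$ when $n>1$, and all $w_i$ non-empty monotone words. A subtree of $T_\gamma$ is stable if all of its vertices are (labelled by) stable curves, and forward-complete if with each vertex it contains both its children; maximal stable means maximal under inclusion among stable subtrees. *)

theory Defs
  imports Complex_Main "HOL-Library.Disjoint_Sets"
begin

section \<open>The free group on two generators\<close>

text \<open>
  \<open>La\<close>, \<open>Lb\<close> are the generators and \<open>LA\<close>, \<open>LB\<close> their formal inverses. The free group is the
  set of all words modulo the equivalence relation generated by deleting a factor
  \<open>x x\<^sup>-\<^sup>1\<close>. It serves as the fundamental group of the once-punctured torus.
\<close>

datatype letter = La | Lb | LA | LB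

fun inv_letter :: "letter \<Rightarrow> letter" where
  "inv_letter La = LA"
| "inv_letter Lb = LB"
| "inv_letter LA = La"
| "inv_letter LB = Lb"

lemma inv_letter_idem [simp]: "inv_letter (inv_letter x) = x"
  by (cases x) auto

inductive cancel :: "letter list \<Rightarrow> letter list \<Rightarrow> bool" where
  "cancel (u @ x # inv_letter x # v) (u @ v)"

definition free_eq :: "letter list \<Rightarrow> letter list \<Rightarrow> bool" where
  "free_eq = equivclp cancel"

lemma equivp_free_eq: "equivp free_eq"
  unfolding free_eq_def by (rule equivp_evquivclp)

lemma free_eq_refl [simp]: "free_eq u u"
  using equivp_free_eq by (rule equivp_reflp)

lemma free_eq_sym: "free_eq u v \<Longrightarrow> free_eq v u"
  using equivp_free_eq by (rule equivp_symp)

lemma free_eq_trans: "free_eq u v \<Longrightarrow> free_eq v w \<Longrightarrow> free_eq u w"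
  using equivp_free_eq by (rule equivp_transp)

lemma free_eq_cancel: "free_eq (u @ x # inv_letter x # v) (u @ v)"
  unfolding free_eq_def by (intro r_into_equivclp cancel.intros)

lemma free_eq_lift:
  assumes step: "\<And>u v. cancel u v \<Longrightarrow> free_eq (f u) (f v)" and "free_eq u v"
  shows "free_eq (f u) (f v)"
  using assms(2) unfolding free_eq_def
proof (induction rule: equivclp_induct)
  case base
  then show ?case by (metis free_eq_def free_eq_refl)
next
  case (step y z)
  then show ?case by (metis assms(1) free_eq_def free_eq_sym free_eq_trans)
qed

lemma free_eq_append:
  assumes "free_eq u u'" and "free_eq v v'"
  shows "free_eq (u @ v) (u' @ v')"
proof -
  have "free_eq (u @ v) (u' @ v)"
    by (rule free_eq_lift [OF _ assms(1)])
       (auto elim!: cancel.cases intro: free_eq_cancel)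
  moreover have "free_eq (u' @ v) (u' @ v')"
    by (rule free_eq_lift [OF _ assms(2)])
       (auto elim!: cancel.cases simp flip: append_assoc intro: free_eq_cancel)
  ultimately show ?thesis by (rule free_eq_trans)
qed

definition inv_word :: "letter list \<Rightarrow> letter list" where
  "inv_word w = rev (map inv_letter w)"

lemma free_eq_inv_word: "free_eq u v \<Longrightarrow> free_eq (inv_word u) (inv_word v)"
proof (erule free_eq_lift [rotated])
  fix u v assume "cancel u v"
  then obtain p x q where uv: "u = p @ x # inv_letter x # q" "v = p @ q"
    by (auto elim: cancel.cases)
  then show "free_eq (inv_word u) (inv_word v)"
    using free_eq_cancel [of "inv_word q" x "inv_word p"]
    by (simp add: inv_word_def)
qed

lemma free_eq_inv_word_append: "free_eq (inv_word w @ w) []"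
proof (induction w)
  case Nil
  then show ?case by (simp add: inv_word_def)
next
  case (Cons x w)
  have "free_eq (inv_word (x # w) @ x # w) (inv_word w @ w)"
    using free_eq_cancel [of "inv_word w" "inv_letter x" w] by (simp add: inv_word_def)
  then show ?case using Cons.IH by (rule free_eq_trans)
qed

quotient_type f2 = "letter list" / free_eq
  by (rule equivp_free_eq)

lift_definition of_word :: "letter list \<Rightarrow> f2" is "\<lambda>w. w" .

instantiation f2 :: "{monoid_mult, inverse}"
begin

lift_definition one_f2 :: f2 is "[]" .

lift_definition times_f2 :: "f2 \<Rightarrow> f2 \<Rightarrow> f2" is "(@)"
  by (rule free_eq_append)

lift_definition inverse_f2 :: "f2 \<Rightarrow> f2" is inv_word
  by (rule free_eq_inv_word)

definition divide_f2 :: "f2 \<Rightarrow> f2 \<Rightarrow> f2" where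
  "divide_f2 g h = g * inverse h"

instance
  by standard (transfer; simp)+

end

lemma f2_left_inverse [simp]: "inverse g * g = (1 :: f2)"
  by transfer (rule free_eq_inv_word_append)

lemma f2_right_inverse [simp]: "g * inverse g = (1 :: f2)"
  by (metis f2_left_inverse mult.assoc mult_1_left mult_1_right)

lemma f2_inverse_unique: "g * h = 1 \<Longrightarrow> inverse g = (h :: f2)"
  by (metis f2_left_inverse mult.assoc mult_1_left mult_1_right)

lemma f2_inverse_1 [simp]: "inverse 1 = (1 :: f2)"
  by (rule f2_inverse_unique) simp

lemma f2_inverse_inverse [simp]: "inverse (inverse g) = (g :: f2)"
  by (rule f2_inverse_unique) simp

lemma f2_inverse_mult: "inverse (g * h) = inverse h * inverse (g :: f2)"
  by (rule f2_inverse_unique) (metis f2_right_inverse mult.assoc mult_1_right)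


section \<open>Curves\<close>

text \<open>
  A curve (free homotopy class of an unoriented closed curve) is a conjugacy class of the
  fundamental group, up to inversion.
\<close>

definition same_curve :: "f2 \<Rightarrow> f2 \<Rightarrow> bool" where
  "same_curve g h \<longleftrightarrow> (\<exists>k. g = k * h * inverse k \<or> g = k * inverse h * inverse k)"

lemma same_curve_sym:
  assumes "same_curve g h" shows "same_curve h g"
proof -
  from assms obtain k where "g = k * h * inverse k \<or> g = k * inverse h * inverse k"
    unfolding same_curve_def by blast
  moreover have "inverse k * (k * x * inverse k) * inverse (inverse k) = x" for x
    by (metis f2_inverse_inverse f2_left_inverse mult.assoc mult_1_left mult_1_right)
  ultimately have "h = inverse k * g * inverse (inverse k) \<or>
      h = inverse k * inverse g * inverse (inverse k)"
    by (auto simp: f2_inverse_mult mult.assoc)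
  then show ?thesis unfolding same_curve_def by blast
qed

lemma same_curve_trans:
  assumes "same_curve g h" "same_curve h j" shows "same_curve g j"
proof -
  from assms obtain k l where
    g: "g \<in> {k * h * inverse k, k * inverse h * inverse k}" and
    h: "h \<in> {l * j * inverse l, l * inverse j * inverse l}"
    unfolding same_curve_def by blast
  have conj: "k * (l * x * inverse l) * inverse k = (k * l) * x * inverse (k * l)" for x
    by (simp only: f2_inverse_mult mult.assoc)
  have inv: "inverse (l * x * inverse l) = l * inverse x * inverse l" for x
    by (simp only: f2_inverse_mult f2_inverse_inverse mult.assoc)
  have "h = l * j * inverse l \<and> inverse h = l * inverse j * inverse l \<or>
      h = l * inverse j * inverse l \<and> inverse h = l * j * inverse l"
    using h inv [of j] inv [of "inverse j"] by (simp only: f2_inverse_inverse) blast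
  then have "g = (k * l) * j * inverse (k * l) \<or> g = (k * l) * inverse j * inverse (k * l)"
    using g conj by (metis insertE singletonD)
  then show ?thesis unfolding same_curve_def by blast
qed

lemma equivp_same_curve: "equivp same_curve"
proof (rule equivpI)
  show "reflp same_curve"
    unfolding same_curve_def by (intro reflpI exI [of _ 1]) simp
  show "symp same_curve" by (rule sympI) (rule same_curve_sym)
  show "transp same_curve" by (rule transpI) (rule same_curve_trans)
qed

quotient_type curve = f2 / same_curve
  by (rule equivp_same_curve)

definition curve_of :: "f2 \<Rightarrow> curve" where
  "curve_of = abs_curve"

lemma curve_of_eq_iff: "curve_of g = curve_of h \<longleftrightarrow> same_curve g h"
  unfolding curve_of_def by (rule curve.abs_eq_iff)

text \<open>
  A loop around the puncture is represented by the commutator \<open>abAB\<close>.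
\<close>

definition essential :: "curve \<Rightarrow> bool" where
  "essential \<gamma> \<longleftrightarrow>
     \<gamma> \<noteq> curve_of 1 \<and> (\<forall>k :: int. \<gamma> \<noteq> curve_of (of_word [La, Lb, LA, LB] powi k))"


section \<open>The mapping classes \<open>L\<close> and \<open>R\<close>\<close>

datatype twist = L | R

fun twist_letter :: "twist \<Rightarrow> letter \<Rightarrow> letter list" where
  "twist_letter L La = [La]"
| "twist_letter L Lb = [La, Lb]"
| "twist_letter L LA = [LA]"
| "twist_letter L LB = [LB, LA]"
| "twist_letter R La = [La, Lb]"
| "twist_letter R Lb = [Lb]"
| "twist_letter R LA = [LB, LA]"
| "twist_letter R LB = [LB]"

definition twist_word :: "twist \<Rightarrow> letter list \<Rightarrow> letter list" where
  "twist_word t w = concat (map (twist_letter t) w)"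

lemma twist_letter_inv: "twist_letter t (inv_letter x) = inv_word (twist_letter t x)"
  by (cases t; cases x) (auto simp: inv_word_def)

lemma free_eq_twist_word: "free_eq u v \<Longrightarrow> free_eq (twist_word t u) (twist_word t v)"
proof (erule free_eq_lift [rotated])
  fix u v assume "cancel u v"
  then obtain p x q where uv: "u = p @ x # inv_letter x # q" "v = p @ q"
    by (auto elim: cancel.cases)
  have "free_eq (twist_letter t x @ twist_letter t (inv_letter x)) []"
    using free_eq_inv_word_append [of "twist_letter t (inv_letter x)"]
    by (simp flip: twist_letter_inv)
  then have "free_eq (twist_word t p @ (twist_letter t x @ twist_letter t (inv_letter x))
      @ twist_word t q) (twist_word t p @ [] @ twist_word t q)"
    by (intro free_eq_append) auto
  then show "free_eq (twist_word t u) (twist_word t v)"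
    by (simp add: uv twist_word_def)
qed

lift_definition twist_f2 :: "twist \<Rightarrow> f2 \<Rightarrow> f2" is twist_word
  by (rule free_eq_twist_word)

lemma twist_f2_mult: "twist_f2 t (g * h) = twist_f2 t g * twist_f2 t h"
  by transfer (simp add: twist_word_def)

lemma twist_f2_1 [simp]: "twist_f2 t 1 = 1"
  by transfer (simp add: twist_word_def)

lemma twist_f2_inverse: "twist_f2 t (inverse g) = inverse (twist_f2 t g)"
  by (metis f2_inverse_unique f2_right_inverse twist_f2_1 twist_f2_mult)

lemma same_curve_twist_f2:
  assumes "same_curve g h" shows "same_curve (twist_f2 t g) (twist_f2 t h)"
proof -
  from assms obtain k where "g = k * h * inverse k \<or> g = k * inverse h * inverse k"
    unfolding same_curve_def by blast
  then show ?thesis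
    unfolding same_curve_def
    by (intro exI [of _ "twist_f2 t k"]) (auto simp: twist_f2_mult twist_f2_inverse)
qed

definition twist_curve :: "twist \<Rightarrow> curve \<Rightarrow> curve" where
  "twist_curve t \<gamma> = curve_of (twist_f2 t (rep_curve \<gamma>))"

lemma twist_curve_curve_of: "twist_curve t (curve_of g) = curve_of (twist_f2 t g)"
proof -
  have "same_curve (rep_curve (curve_of g)) g"
    unfolding curve_of_def
    by (rule Quotient3_rep_abs [OF Quotient3_curve])
       (rule equivp_reflp [OF equivp_same_curve])
  then show ?thesis
    unfolding twist_curve_def curve_of_eq_iff by (rule same_curve_twist_f2)
qed


section \<open>Stable curves\<close>

definition zz :: f2 where
  "zz = of_word [La, LB, LA, Lb]"

definition monotone_word :: "letter list \<Rightarrow> bool" where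
  "monotone_word w \<longleftrightarrow> set w \<subseteq> {La, Lb} \<or> set w \<subseteq> {LA, LB}"

text \<open>
  The list holds the pairs \<open>(e\<^sub>i, w\<^sub>i)\<close> for \<open>i = 1, \<dots>, n\<close>, with \<open>n \<ge> 1\<close>. The product is taken in
  the group, so no literal equality of words is required.
\<close>

definition stable_curve :: "curve \<Rightarrow> bool" where
  "stable_curve \<gamma> \<longleftrightarrow>
     (\<exists>g ews. \<gamma> = curve_of g \<and> g = prod_list (map (\<lambda>(e, w). zz powi e * of_word w) ews) \<and>
        ews \<noteq> [] \<and>
        (length ews > 1 \<longrightarrow> (\<forall>(e, w) \<in> set ews. e \<noteq> 0)) \<and>
        (\<forall>(e, w) \<in> set ews. w \<noteq> [] \<and> monotone_word w))"


section \<open>The binary tree of a curve\<close>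

text \<open>
  The free monoid of positive products of \<open>L\<close> and \<open>R\<close> is \<^typ>\<open>twist list\<close>: the list
  \<open>[t\<^sub>1, \<dots>, t\<^sub>k]\<close> is the product \<open>t\<^sub>1 \<cdots> t\<^sub>k\<close>, whose last factor acts first. Thus the vertex set
  of the tree is \<^term>\<open>UNIV :: twist list set\<close> for every curve, only the labels depend on the
  curve, and the children of \<open>v\<close> are \<open>L # v\<close> and \<open>R # v\<close>.
\<close>

definition label :: "curve \<Rightarrow> twist list \<Rightarrow> curve" where
  "label \<gamma> v = foldr twist_curve v \<gamma>"

definition child :: "twist list \<Rightarrow> twist list \<Rightarrow> bool" where
  "child v v' \<longleftrightarrow> v' = L # v \<or> v' = R # v"

text \<open>A subtree is the vertex set of a non-empty connected subgraph.\<close>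

definition subtree :: "twist list set \<Rightarrow> bool" where
  "subtree S \<longleftrightarrow> S \<noteq> {} \<and>
     (\<forall>u\<in>S. \<forall>v\<in>S. (u, v) \<in> {(x, y). x \<in> S \<and> y \<in> S \<and> (child x y \<or> child y x)}\<^sup>*)"

definition forward_complete :: "twist list set \<Rightarrow> bool" where
  "forward_complete S \<longleftrightarrow> (\<forall>v\<in>S. \<forall>v'. child v v' \<longrightarrow> v' \<in> S)"

definition stable_subtree :: "curve \<Rightarrow> twist list set \<Rightarrow> bool" where
  "stable_subtree \<gamma> S \<longleftrightarrow> subtree S \<and> (\<forall>v\<in>S. stable_curve (label \<gamma> v))"

definition maximal_stable_subtree :: "curve \<Rightarrow> twist list set \<Rightarrow> bool" where
  "maximal_stable_subtree \<gamma> S \<longleftrightarrow>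
     stable_subtree \<gamma> S \<and> (\<forall>S'. stable_subtree \<gamma> S' \<and> S \<subseteq> S' \<longrightarrow> S' = S)"

end

theory Submission imports Defs begin

text \<open>
  Write a curve as a cyclic product of syllables, i.e. of positive and negative words. If signs
  alternate and the product is cyclically reduced, then \<open>L\<close> cancels one letter at each turn from
  negative to positive and \<open>R\<close> one letter at each turn from positive to negative, so both twists act
  syllable by syllable. A syllable that is a power \<open>x\<^sup>n\<close> of a single generator becomes shorter under
  one twist and, if \<open>n > 1\<close>, contains both generators after the other one; syllables containing both
  generators keep this property. Hence, if every syllable is either mixed or of length one, and the
  syllables of length one all come from \<open>{a, A}\<close> or all from \<open>{b, B}\<close>, nothing needs to decrease,
  and otherwise both twists strictly decrease the total length of the non-mixed syllables or kill a
  syllable. In the first case the curve is stable: conjugating every syllable suitably turns the runs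
  at its two ends into powers such as \<open>B a\<^sup>k b = (z\<^sup>-\<^sup>1 a)\<^sup>k\<close>, and the powers of \<open>z\<close> that meet
  have equal signs. Since the twists fix \<open>z\<close> and preserve monotone words, stability is inherited by
  children, and the tree decomposes at the minimal stable vertices.
\<close>

section \<open>Twists and the element z\<close>

lemma of_word_Nil [simp]: "of_word [] = 1"
  by transfer simp

lemma of_word_append: "of_word (u @ v) = of_word u * of_word v"
  by transfer simp

lemma of_word_Cons: "of_word (x # v) = of_word [x] * of_word v"
  using of_word_append [of "[x]" v] by simp

lemma of_word_inv_cancel: "of_word [x] * of_word [inv_letter x] = 1"
  by transfer (use free_eq_cancel [of "[]" _ "[]"] in simp)

lemma f2_cancel_left [simp]: "g * h = 1 \<Longrightarrow> g * (h * k) = (k :: f2)"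
  by (metis mult.assoc mult_1_left)

lemma same_curve_refl [simp]: "same_curve g g"
  using equivp_same_curve by (rule equivp_reflp)

lemma same_curve_conj: "same_curve (k * g * inverse k) g"
  unfolding same_curve_def by blast

lemma same_curve_rotate: "same_curve (g * h) (h * g)"
  using same_curve_conj [of g "h * g"] by (simp add: mult.assoc)

text \<open>Letter images under the inverse automorphisms. They serve to pull a power of z back
  along a twist, and so to show that twists keep curves essential.\<close>

definition untwist_letter :: "twist \<Rightarrow> letter \<Rightarrow> letter list" where
  "untwist_letter t x = (case t of
     L \<Rightarrow> (case x of Lb \<Rightarrow> [LA, Lb] | LB \<Rightarrow> [LB, La] | _ \<Rightarrow> [x])
   | R \<Rightarrow> (case x of La \<Rightarrow> [La, LB] | LA \<Rightarrow> [Lb, LA] | _ \<Rightarrow> [x]))"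

lemma free_eq_subst_word:
  assumes inv: "\<And>x. f (inv_letter x) = inv_word (f x)" and "free_eq u v"
  shows "free_eq (concat (map f u)) (concat (map f v))"
proof (rule free_eq_lift [OF _ assms(2)])
  fix u v assume "cancel u v"
  then obtain p x q where uv: "u = p @ x # inv_letter x # q" "v = p @ q"
    by (auto elim: cancel.cases)
  have "free_eq (f x @ f (inv_letter x)) []"
    using free_eq_inv_word_append [of "f (inv_letter x)"] by (simp flip: inv)
  then have "free_eq (concat (map f p) @ (f x @ f (inv_letter x)) @ concat (map f q))
      (concat (map f p) @ [] @ concat (map f q))"
    by (intro free_eq_append) auto
  then show "free_eq (concat (map f u)) (concat (map f v))"
    by (simp add: uv)
qed

lift_definition untwist_f2 :: "twist \<Rightarrow> f2 \<Rightarrow> f2" is "\<lambda>t w. concat (map (untwist_letter t) w)"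
proof (rule free_eq_subst_word)
  show "untwist_letter t (inv_letter x) = inv_word (untwist_letter t x)" for t x
    by (cases t; cases x) (auto simp: untwist_letter_def inv_word_def)
qed

lemma untwist_f2_mult: "untwist_f2 t (g * h) = untwist_f2 t g * untwist_f2 t h"
  by transfer simp

lemma untwist_f2_1 [simp]: "untwist_f2 t 1 = 1"
  by transfer simp

lemma untwist_f2_inverse: "untwist_f2 t (inverse g) = inverse (untwist_f2 t g)"
  by (metis f2_inverse_unique f2_right_inverse untwist_f2_1 untwist_f2_mult)

lemma twist_of_word: "twist_f2 t (of_word w) = of_word (twist_word t w)"
  by transfer simp

lemma untwist_of_word: "untwist_f2 t (of_word w) = of_word (concat (map (untwist_letter t) w))"
  by transfer simp

lemma of_word_cancel [simp]:
  "of_word [La] * of_word [LA] = 1" "of_word [LA] * of_word [La] = 1"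
  "of_word [Lb] * of_word [LB] = 1" "of_word [LB] * of_word [Lb] = 1"
  using of_word_inv_cancel [of La] of_word_inv_cancel [of LA]
    of_word_inv_cancel [of Lb] of_word_inv_cancel [of LB] by simp_all

lemma of_word_exhaust: "\<exists>w. g = of_word w"
  by (induction g rule: f2.abs_induct) (auto simp flip: of_word.abs_eq)

lemma untwist_twist [simp]: "untwist_f2 t (twist_f2 t g) = g"
proof -
  have letter: "untwist_f2 t (of_word (twist_letter t x)) = of_word [x]" for x
    by (cases t; cases x)
      (simp_all add: untwist_of_word untwist_letter_def untwist_f2_mult mult.assoc
        of_word_Cons [of _ "_ # _"])
  have "untwist_f2 t (twist_f2 t (of_word w)) = of_word w" for w
  proof (induction w)
    case (Cons x w)
    have "twist_f2 t (of_word (x # w)) = of_word (twist_letter t x) * twist_f2 t (of_word w)"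
      by (simp add: twist_of_word twist_word_def of_word_append)
    then show ?case
      using Cons.IH letter by (simp add: untwist_f2_mult of_word_Cons [of x w])
  qed simp
  moreover obtain w where "g = of_word w"
    using of_word_exhaust by blast
  ultimately show ?thesis by simp
qed

lemma same_curve_untwist:
  assumes "same_curve g h" shows "same_curve (untwist_f2 t g) (untwist_f2 t h)"
proof -
  from assms obtain k where "g = k * h * inverse k \<or> g = k * inverse h * inverse k"
    unfolding same_curve_def by blast
  then show ?thesis
    unfolding same_curve_def
    by (intro exI [of _ "untwist_f2 t k"]) (auto simp: untwist_f2_mult untwist_f2_inverse)
qed

lemma twist_f2_power: "twist_f2 t (g ^ n) = twist_f2 t g ^ n"
  by (induction n) (simp_all add: twist_f2_mult)

lemma untwist_f2_power: "untwist_f2 t (g ^ n) = untwist_f2 t g ^ n"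
  by (induction n) (simp_all add: untwist_f2_mult)

text \<open>The element z is fixed on the nose, not only up to conjugacy; for \<open>L\<close>, the
  image \<open>a BA A ab\<close> of \<open>aBAb\<close> reduces to \<open>aBAb\<close>.\<close>

lemma zz_twist [simp]: "twist_f2 t zz = zz"
  by (cases t)
    (simp_all add: zz_def twist_of_word twist_word_def twist_f2_mult mult.assoc
      of_word_Cons [of _ "_ # _"])

lemma zz_untwist [simp]: "untwist_f2 t zz = zz"
  using untwist_twist [of t zz] by simp

lemma twist_zz_powi [simp]: "twist_f2 t (zz powi e) = zz powi e"
  by (simp add: power_int_def twist_f2_power twist_f2_inverse)

section \<open>Peripheral curves and essential curves\<close>

lemma f2_power_conj: "(k * g * inverse k) ^ n = k * g ^ n * inverse (k :: f2)"
  by (induction n) (simp_all add: mult.assoc)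

lemma f2_inverse_power: "inverse (g ^ n) = inverse (g :: f2) ^ n"
proof (induction n)
  case (Suc n)
  then show ?case by (simp add: f2_inverse_mult power_commutes)
qed simp

text \<open>The commutator is \<open>b z^-1 B\<close>, and curves ignore conjugation and inversion,
  so natural powers of z account for every power of the loop around the puncture.\<close>

lemma commutator_powi_curve:
  "same_curve (of_word [La, Lb, LA, LB] powi k) (zz ^ nat \<bar>k\<bar>)" (is "same_curve (?c powi k) _")
proof -
  let ?b = "of_word [Lb]"
  have b: "inverse ?b = of_word [LB]"
    by (rule f2_inverse_unique) simp
  have "inverse zz = of_word [LB, La, Lb, LA]"
    by (rule f2_inverse_unique) (simp add: zz_def of_word_Cons [of _ "_ # _"] mult.assoc)
  then have c: "?c = ?b * inverse zz * inverse ?b"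
    by (simp add: b of_word_Cons [of _ "_ # _"] mult.assoc)
  then have inv_c: "inverse ?c = ?b * zz * inverse ?b"
    by (simp add: f2_inverse_mult mult.assoc)
  have "?c powi k = ?b * inverse (zz ^ nat \<bar>k\<bar>) * inverse ?b" if "k \<ge> 0"
    using that by (simp add: power_int_def c f2_power_conj f2_inverse_power)
  moreover have "?c powi k = ?b * zz ^ nat \<bar>k\<bar> * inverse ?b" if "k < 0"
    using that inv_c by (simp add: power_int_def f2_power_conj)
  ultimately show ?thesis
    unfolding same_curve_def by (metis linorder_not_le)
qed

lemma essential_iff: "essential (curve_of g) \<longleftrightarrow> (\<forall>n. \<not> same_curve g (zz ^ n))"
proof
  assume g: "essential (curve_of g)"
  show "\<forall>n. \<not> same_curve g (zz ^ n)"
  proof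
    show "\<not> same_curve g (zz ^ n)" for n
      using g commutator_powi_curve [of "int n"] unfolding essential_def curve_of_eq_iff
      by (metis abs_of_nat nat_int same_curve_sym same_curve_trans)
  qed
next
  assume "\<forall>n. \<not> same_curve g (zz ^ n)"
  then show "essential (curve_of g)"
    unfolding essential_def curve_of_eq_iff
    by (metis commutator_powi_curve power_0 same_curve_trans)
qed

lemma essential_twist:
  assumes "essential (curve_of g)" shows "essential (curve_of (twist_f2 t g))"
  unfolding essential_iff
proof
  show "\<not> same_curve (twist_f2 t g) (zz ^ n)" for n
    using assms same_curve_untwist [of "twist_f2 t g" "zz ^ n" t]
    by (auto simp: essential_iff untwist_f2_power)
qed

text \<open>A twist fixes every power of z and sends a non-empty monotone word to a non-empty
  monotone word, so it acts on a stable factorization block by block with the same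
  exponents.\<close>

lemma stable_curve_twist:
  assumes "stable_curve \<gamma>" shows "stable_curve (twist_curve t \<gamma>)"
proof -
  from assms obtain ews where \<gamma>: "\<gamma> = curve_of (prod_list (map (\<lambda>(e, w). zz powi e * of_word w) ews))"
    and ews: "ews \<noteq> []" "length ews > 1 \<longrightarrow> (\<forall>(e, w) \<in> set ews. e \<noteq> 0)"
      "\<forall>(e, w) \<in> set ews. w \<noteq> [] \<and> monotone_word w"
    unfolding stable_curve_def by blast
  define ews' where "ews' = map (\<lambda>(e, w). (e, twist_word t w)) ews"
  have "twist_f2 t (prod_list (map (\<lambda>(e, w). zz powi e * of_word w) ews)) =
      prod_list (map (\<lambda>(e, w). zz powi e * of_word w) ews')"
    unfolding ews'_def by (induction ews) (auto simp: twist_f2_mult twist_of_word)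
  moreover have "twist_word t w \<noteq> [] \<and> monotone_word (twist_word t w)"
    if "w \<noteq> []" "monotone_word w" for w
  proof
    have "twist_letter t x \<noteq> []" for x
      by (cases t; cases x) auto
    with \<open>w \<noteq> []\<close> show "twist_word t w \<noteq> []"
      by (cases w) (auto simp: twist_word_def)
    have "set (twist_letter t x) \<subseteq> S" if "x \<in> S" "S = {La, Lb} \<or> S = {LA, LB}" for x S
      using that by (cases t; cases x) auto
    then show "monotone_word (twist_word t w)"
      using \<open>monotone_word w\<close> unfolding monotone_word_def twist_word_def
      by (simp add: UN_subset_iff) blast
  qed
  ultimately show ?thesis
    unfolding stable_curve_def \<gamma> twist_curve_curve_of using ews
    by (intro exI [of _ "prod_list (map (\<lambda>(e, w). zz powi e * of_word w) ews')"] exI [of _ ews'])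
      (auto simp: ews'_def)
qed


section \<open>Cyclic lists\<close>

definition cyclic :: "('a \<Rightarrow> 'a \<Rightarrow> bool) \<Rightarrow> 'a list \<Rightarrow> bool" where
  "cyclic P xs \<longleftrightarrow> successively P xs \<and> (xs \<noteq> [] \<longrightarrow> P (last xs) (hd xs))"

lemma cyclic_rotate: "cyclic P (xs @ ys) \<longleftrightarrow> cyclic P (ys @ xs)"
  by (cases "xs = []"; cases "ys = []") (auto simp: cyclic_def successively_append_iff)

lemma not_successively_split:
  "\<not> successively P xs \<Longrightarrow> \<exists>us x y vs. xs = us @ x # y # vs \<and> \<not> P x y"
proof (induction P xs rule: successively.induct)
  case (3 P x y xs)
  show ?case
  proof (cases "P x y")
    case True
    then obtain us x' y' vs where "y # xs = us @ x' # y' # vs" "\<not> P x' y'"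
      using 3 by auto
    then show ?thesis by (metis append_Cons)
  next
    case False
    then show ?thesis by (metis append_Nil)
  qed
qed auto

lemma not_cyclic_rotation:
  assumes "\<not> cyclic P xs" "length xs \<ge> 2"
  obtains us vs x y zs where "xs = us @ vs" "vs @ us = x # y # zs" "\<not> P x y"
proof (cases "successively P xs")
  case True
  with assms have no: "\<not> P (last xs) (hd xs)" "xs \<noteq> []"
    by (auto simp: cyclic_def)
  have xs: "xs = butlast xs @ [last xs]" using no by simp
  have "butlast xs = hd xs # tl (butlast xs)"
    using assms(2) by (cases xs; cases "tl xs") auto
  then show ?thesis
    using that [of "butlast xs" "[last xs]" "last xs" "hd xs" "tl (butlast xs)"] xs no by simp
next
  case False
  then obtain us x y vs where "xs = us @ x # y # vs" "\<not> P x y"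
    using not_successively_split by blast
  then show ?thesis
    using that [of us "x # y # vs" x y "vs @ us"] by simp
qed

text \<open>The cut is made at the end of the first run of elements satisfying \<open>P\<close>.
  This later opens a cyclic symbol word so that it starts with a power of z and ends with a
  letter.\<close>

lemma rotate_to_boundary:
  assumes "x \<in> set xs" "P x" "y \<in> set xs" "\<not> P y"
  obtains us vs where "xs = us @ vs" "\<not> P (hd (vs @ us))" "P (last (vs @ us))"
proof -
  define us where "us = takeWhile (\<lambda>x. \<not> P x) xs"
  define xs' where "xs' = dropWhile (\<lambda>x. \<not> P x) xs"
  define us' where "us' = takeWhile P xs'"
  define vs where "vs = dropWhile P xs'"
  have "xs' \<noteq> []" unfolding xs'_def using assms by (auto simp: dropWhile_eq_Nil_conv)
  moreover from this have "P (hd xs')" using hd_dropWhile [of "\<lambda>x. \<not> P x" xs] unfolding xs'_def by simp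
  ultimately have us': "us' \<noteq> []"
    unfolding us'_def by (cases xs') auto
  then have "P (last us')"
    unfolding us'_def by (metis last_in_set set_takeWhileD)
  moreover have "xs = (us @ us') @ vs"
    unfolding us_def us'_def vs_def xs'_def by simp
  moreover have "\<not> P (hd (vs @ us @ us'))"
  proof (cases "vs = []")
    case True
    have "us \<noteq> []"
    proof
      assume "us = []"
      then have "xs = us'" using True \<open>xs = (us @ us') @ vs\<close> by simp
      then show False using assms unfolding us'_def by (metis set_takeWhileD)
    qed
    then have "\<not> P (hd us)" unfolding us_def by (metis hd_in_set set_takeWhileD)
    then show ?thesis using True \<open>us \<noteq> []\<close> by simp
  next
    case False
    then have "\<not> P (hd vs)" unfolding vs_def by (rule hd_dropWhile)
    then show ?thesis using False by simp
  qed
  ultimately show ?thesis using that [of "us @ us'" vs] us' by simp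
qed

lemma curve_prod_rotate:
  "curve_of (prod_list (map f (xs @ ys))) = curve_of (prod_list (map f (ys @ xs)))"
  by (simp add: curve_of_eq_iff same_curve_rotate)

lemma f2_inverse_eqI: "g * h = 1 \<Longrightarrow> g = inverse (h :: f2)"
  by (metis f2_inverse_inverse f2_inverse_unique)

text \<open>Each right factor cancels the next left factor; only the outermost pair survives, and by
  the cyclic condition it is a conjugation.\<close>

lemma telescope_curve:
  fixes f :: "'a \<Rightarrow> f2"
  assumes f: "\<And>x. x \<in> set xs \<Longrightarrow> f x = l x * h x * r x"
    and cyc: "cyclic (\<lambda>x y. r x * l y = 1) xs"
  shows "curve_of (prod_list (map f xs)) = curve_of (prod_list (map h xs))"
proof (cases "xs = []")
  case False
  have "xs \<noteq> [] \<Longrightarrow> (\<And>x. x \<in> set xs \<Longrightarrow> f x = l x * h x * r x) \<Longrightarrow>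
      successively (\<lambda>x y. r x * l y = 1) xs \<Longrightarrow>
      prod_list (map f xs) = l (hd xs) * prod_list (map h xs) * r (last xs)"
  proof (induction xs)
    case (Cons x xs)
    then show ?case
      by (cases xs) (auto simp: mult.assoc)
  qed simp
  then have *: "prod_list (map f xs) = l (hd xs) * prod_list (map h xs) * r (last xs)"
    using False f cyc unfolding cyclic_def by blast
  have "r (last xs) * l (hd xs) = 1"
    using cyc False unfolding cyclic_def by blast
  then have "r (last xs) = inverse (l (hd xs))"
    by (rule f2_inverse_eqI)
  then show ?thesis
    unfolding * curve_of_eq_iff by (simp add: same_curve_conj)
qed simp

section \<open>Cyclic words in letters and powers of z\<close>

text \<open>
  The first argument is the sign. The second one is chosen such that adjacent letters of opposite
  sign form a reduced word iff their second arguments agree, and such that swapping the sign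
  is the automorphism \<open>a \<mapsto> B, b \<mapsto> A\<close>, which inverts \<open>z\<close>.
\<close>

fun ltr :: "bool \<Rightarrow> bool \<Rightarrow> letter" where
  "ltr True True = La"
| "ltr True False = Lb"
| "ltr False True = LB"
| "ltr False False = LA"

lemma inv_letter_ltr: "inv_letter (ltr s i) = ltr (\<not> s) (\<not> i)"
  by (cases s; cases i) auto

definition gen :: "bool \<Rightarrow> bool \<Rightarrow> f2" where
  "gen s i = of_word [ltr s i]"

lemma gen_cancel [simp]: "s \<noteq> s' \<Longrightarrow> i \<noteq> i' \<Longrightarrow> gen s i * gen s' i' = 1"
  using of_word_inv_cancel [of "ltr s i"] by (simp add: gen_def inv_letter_ltr)

definition syl :: "bool \<Rightarrow> bool list \<Rightarrow> f2" where
  "syl s x = of_word (map (ltr s) x)"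

lemma syl_simps [simp]:
  "syl s [] = 1" "syl s (i # x) = gen s i * syl s x" "syl s (x @ y) = syl s x * syl s y"
  by (simp_all add: syl_def gen_def of_word_append of_word_Cons [of _ "map _ _"])

lemma monotone_map_ltr: "monotone_word (map (ltr s) x)"
  unfolding monotone_word_def
proof (cases s)
  case True
  have "ltr True i \<in> {La, Lb}" for i by (cases i) auto
  with True show "set (map (ltr s) x) \<subseteq> {La, Lb} \<or> set (map (ltr s) x) \<subseteq> {LA, LB}" by auto
next
  case False
  have "ltr False i \<in> {LA, LB}" for i by (cases i) auto
  with False show "set (map (ltr s) x) \<subseteq> {La, Lb} \<or> set (map (ltr s) x) \<subseteq> {LA, LB}" by auto
qed

text \<open>Spelled uniformly in the sign, so that z and its inverse are treated by the same
  computations.\<close>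

definition zeta :: "bool \<Rightarrow> f2" where
  "zeta s = gen (\<not> s) True * gen s True * gen s False * gen (\<not> s) False"

lemma zeta_False: "zeta False = zz"
  by (simp add: zeta_def gen_def zz_def of_word_Cons [of _ "_ # _"] mult.assoc)

lemma zeta_True: "zeta True = inverse zz"
  by (rule f2_inverse_unique [symmetric])
    (simp add: mult.assoc zeta_def flip: zeta_False)

section \<open>Symbol words and their compatibility\<close>

datatype sym = Ltr bool bool | Zed bool
datatype sym_class = CL bool | CZ bool

fun sym_val :: "sym \<Rightarrow> f2" where
  "sym_val (Ltr s i) = gen s i"
| "sym_val (Zed s) = zeta s"

fun cls :: "sym \<Rightarrow> sym_class" where
  "cls (Ltr s i) = CL s"
| "cls (Zed s) = CZ s"

text \<open>Sign changes are forbidden inside a run of letters and inside a run of powers of z.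
  Hence runs of letters are monotone words and runs of \<open>Zed\<close> multiply to non-zero
  powers of z.\<close>

fun compat :: "sym_class \<Rightarrow> sym_class \<Rightarrow> bool" where
  "compat (CL s) (CL s') \<longleftrightarrow> s = s'"
| "compat (CZ s) (CZ s') \<longleftrightarrow> s = s'"
| "compat _ _ \<longleftrightarrow> True"

fun is_ltr :: "sym \<Rightarrow> bool" where
  "is_ltr (Ltr _ _) \<longleftrightarrow> True"
| "is_ltr (Zed _) \<longleftrightarrow> False"

lemma compat_all_Zed:
  "successively compat (map cls w) \<Longrightarrow> \<forall>x\<in>set w. \<not> is_ltr x \<Longrightarrow> \<exists>s n. w = replicate n (Zed s)"
proof (induction w)
  case (Cons x w)
  from Cons.prems obtain s where x: "x = Zed s" by (cases x) auto
  show ?case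
  proof (cases w)
    case (Cons y v)
    with Cons.IH Cons.prems obtain s' n where w: "w = replicate n (Zed s')"
      by (auto simp: successively_Cons)
    then have "y = Zed s'" using Cons by (cases n) auto
    then have "s = s'" using Cons.prems Cons x by simp
    then have "x # w = replicate (Suc n) (Zed s)" using w x by simp
    then show ?thesis by (intro exI)
  next
    case Nil
    then have "x # w = replicate 1 (Zed s)" using x by simp
    then show ?thesis by (intro exI)
  qed
qed simp

lemma compat_all_Ltr:
  "successively compat (map cls w) \<Longrightarrow> \<forall>x\<in>set w. is_ltr x \<Longrightarrow> \<exists>s m. w = map (Ltr s) m"
proof (induction w)
  case (Cons x w)
  from Cons.prems obtain s i where x: "x = Ltr s i" by (cases x) auto
  show ?case
  proof (cases w)
    case Nil
    then have "x # w = map (Ltr s) [i]" using x by simp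
    then show ?thesis by (intro exI)
  next
    case (Cons y v)
    have "successively compat (map cls w)" "\<forall>x\<in>set w. is_ltr x"
      using Cons.prems Cons by (simp_all add: successively_Cons)
    then obtain s' m where w: "w = map (Ltr s') m"
      using Cons.IH by blast
    then have "cls y = CL s'" using Cons by auto
    then have "s = s'" using Cons.prems Cons x by simp
    then have "x # w = map (Ltr s) (i # m)" using w x by simp
    then show ?thesis by (intro exI)
  qed
qed simp

lemma sym_val_map_Ltr: "prod_list (map sym_val (map (Ltr s) m)) = syl s m"
  by (induction m) simp_all

text \<open>The sign condition excludes cancellation: both factors are powers of the same one of z
  and its inverse.\<close>

lemma zeta_mult_powi:
  assumes "e = 0 \<or> sgn e = (if s then -1 else 1)"
  shows "zeta s * zz powi e = zz powi (e + (if s then -1 else 1))"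
proof (cases s)
  case True
  with assms have "e \<le> 0" by (auto simp: sgn_if split: if_splits)
  then have "nat (- e + 1) = Suc (nat (- e))" by simp
  then show ?thesis
    using True \<open>e \<le> 0\<close> by (auto simp: zeta_True power_int_def)
next
  case False
  with assms have "e \<ge> 0" by (auto simp: sgn_if split: if_splits)
  then have "nat (e + 1) = Suc (nat e)" by simp
  then show ?thesis
    using False \<open>e \<ge> 0\<close> by (auto simp: zeta_False power_int_def)
qed

section \<open>Collecting symbol words into blocks\<close>

definition block_prod :: "(int \<times> letter list) list \<Rightarrow> f2" where
  "block_prod ews = prod_list (map (\<lambda>(e, w). zz powi e * of_word w) ews)"

lemma block_prod_simps [simp]:
  "block_prod [] = 1" "block_prod ((e, w) # ews) = zz powi e * (of_word w * block_prod ews)"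
  by (simp_all add: block_prod_def mult.assoc)

text \<open>The first block is kept apart because its exponent may be 0. The last two clauses
  remember the first symbol, so that a compatible symbol put in front can be merged into this
  block.\<close>

definition factors :: "sym list \<Rightarrow> int \<Rightarrow> letter list \<Rightarrow> (int \<times> letter list) list \<Rightarrow> bool" where
  "factors w e l ews \<longleftrightarrow> prod_list (map sym_val w) = block_prod ((e, l) # ews) \<and>
    l \<noteq> [] \<and> monotone_word l \<and>
    (\<forall>(e, w) \<in> set ews. e \<noteq> 0 \<and> w \<noteq> [] \<and> monotone_word w) \<and>
    (\<forall>s. cls (hd w) = CL s \<longrightarrow> e = 0 \<and> (\<exists>m. l = map (ltr s) m)) \<and>
    (\<forall>s. cls (hd w) = CZ s \<longrightarrow> sgn e = (if s then -1 else 1))"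

lemma factors_Ltr:
  assumes "prod_list (map sym_val w) = syl s m * block_prod ews"
    and "\<forall>(e, w) \<in> set ews. e \<noteq> 0 \<and> w \<noteq> [] \<and> monotone_word w"
  shows "factors (Ltr s i # w) 0 (map (ltr s) (i # m)) ews"
proof -
  have "of_word (map (ltr s) (i # m)) = gen s i * syl s m"
    by (metis syl_def syl_simps(2))
  then have "prod_list (map sym_val (Ltr s i # w)) = block_prod ((0, map (ltr s) (i # m)) # ews)"
    using assms(1) by (simp add: mult.assoc)
  moreover have "monotone_word (map (ltr s) (i # m))" by (rule monotone_map_ltr)
  ultimately show ?thesis
    unfolding factors_def using assms(2) by (auto intro: exI [of _ "i # m"])
qed

text \<open>The word is read from right to left: a new symbol extends the first block or opens
  another one. Ending in a letter provides a non-empty word after the last power of z.\<close>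

lemma sym_word_factors:
  "successively compat (map cls w) \<Longrightarrow> w \<noteq> [] \<Longrightarrow> is_ltr (last w) \<Longrightarrow> \<exists>e l ews. factors w e l ews"
proof (induction w)
  case (Cons x w)
  show ?case
  proof (cases "w = []")
    case True
    then obtain s i where x: "x = Ltr s i" using Cons.prems by (cases x) auto
    have "factors (x # w) 0 (map (ltr s) [i]) []"
      unfolding x by (rule factors_Ltr) (use True in auto)
    then show ?thesis by (intro exI)
  next
    case False
    have "successively compat (map cls w)" "is_ltr (last w)"
      using False Cons.prems by (simp_all add: successively_Cons)
    then obtain e l ews where IH: "factors w e l ews"
      using Cons.IH False by blast
    have comp: "compat (cls x) (cls (hd w))"
      using Cons.prems False by (simp add: successively_Cons hd_map)
    show ?thesis
    proof (cases x)
      case x: (Ltr s i)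
      show ?thesis
      proof (cases "cls (hd w)")
        case (CL s')
        then have "s' = s" using comp x by simp
        with CL IH obtain m where m: "l = map (ltr s) m" "e = 0" unfolding factors_def by blast
        have "factors (x # w) 0 (map (ltr s) (i # m)) ews"
          unfolding x by (rule factors_Ltr) (use IH m in \<open>auto simp: factors_def syl_def\<close>)
        then show ?thesis by (intro exI)
      next
        case (CZ s')
        then have "sgn e = (if s' then -1 else 1)" using IH unfolding factors_def by blast
        \<comment> \<open>The old first block becomes an inner one, where exponent 0 is not
          allowed.\<close>
        then have "e \<noteq> 0" by (auto split: if_splits)
        then have "factors (x # w) 0 (map (ltr s) [i]) ((e, l) # ews)"
          unfolding x by (intro factors_Ltr) (use IH in \<open>auto simp: factors_def\<close>)
        then show ?thesis by (intro exI)
      qed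
    next
      case x: (Zed s)
      \<comment> \<open>The exponent is 0 if the rest starts with a letter; otherwise compatibility
        gives it the sign of the new factor.\<close>
      have e: "e = 0 \<or> sgn e = (if s then -1 else 1)"
        using comp x IH by (cases "cls (hd w)") (auto simp: factors_def)
      then have "sgn (e + (if s then -1 else 1)) = (if s then -1 else 1)"
        by (auto simp: sgn_if split: if_splits)
      moreover have "zeta s * block_prod ((e, l) # ews) =
          block_prod ((e + (if s then -1 else 1), l) # ews)"
        by (simp only: block_prod_simps mult.assoc [symmetric] zeta_mult_powi [OF e])
      then have "prod_list (map sym_val (x # w)) =
          block_prod ((e + (if s then -1 else 1), l) # ews)"
        using IH x unfolding factors_def by simp
      ultimately have "factors (x # w) (e + (if s then -1 else 1)) l ews"
        using IH x unfolding factors_def by (simp del: block_prod_simps)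
      then show ?thesis by (intro exI)
    qed
  qed
qed simp

lemma factors_stable:
  assumes "factors w e l ews" "\<not> is_ltr (hd w)"
  shows "stable_curve (curve_of (prod_list (map sym_val w)))"
proof -
  obtain s where "cls (hd w) = CZ s" using assms(2) by (cases "hd w") auto
  then have "sgn e = (if s then -1 else 1)" using assms(1) unfolding factors_def by blast
  then have "e \<noteq> 0" by (auto split: if_splits)
  then show ?thesis
    unfolding stable_curve_def using assms(1)
    by (intro exI [of _ "prod_list (map sym_val w)"] exI [of _ "(e, l) # ews"])
      (auto simp: factors_def block_prod_def)
qed

text \<open>The class \<open>p\<close> belongs to a symbol preceding the word and \<open>q\<close>
  to the last symbol seen, so an empty word forces \<open>p = q\<close> and paths compose.\<close>

definition sym_path :: "sym_class \<Rightarrow> f2 \<Rightarrow> sym_class \<Rightarrow> bool" where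
  "sym_path p g q \<longleftrightarrow> (\<exists>w. g = prod_list (map sym_val w) \<and>
     successively compat (p # map cls w) \<and> last (p # map cls w) = q)"

lemma sym_path_1: "sym_path p 1 p"
  unfolding sym_path_def by (rule exI [of _ "[]"]) simp

lemma sym_path_sym: "compat p (cls x) \<Longrightarrow> sym_path p (sym_val x) (cls x)"
  unfolding sym_path_def by (rule exI [of _ "[x]"]) simp

lemma sym_path_trans:
  assumes "sym_path p g q" "sym_path q h r" shows "sym_path p (g * h) r"
proof -
  obtain v w where v: "g = prod_list (map sym_val v)" "successively compat (p # map cls v)"
      "last (p # map cls v) = q"
    and w: "h = prod_list (map sym_val w)" "successively compat (q # map cls w)"
      "last (q # map cls w) = r"
    using assms unfolding sym_path_def by blast
  have "successively compat ((p # map cls v) @ map cls w)"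
    unfolding successively_append_iff using v w by (auto simp: successively_Cons)
  moreover have "last ((p # map cls v) @ map cls w) = r"
    using v w by (cases w) auto
  ultimately show ?thesis
    unfolding sym_path_def using v w by (intro exI [of _ "v @ w"]) auto
qed

text \<open>A loop spells a cyclically compatible word. Only letters give one monotone word, where
  exponent 0 is allowed; only \<open>Zed\<close> symbols give a power of z; a word with both kinds
  is rotated to start with \<open>Zed\<close> and end with a letter, and all its exponents are
  non-zero.\<close>

lemma sym_path_loop:
  assumes "sym_path p g p"
  shows "stable_curve (curve_of g) \<or> (\<exists>n. same_curve g (zz ^ n))"
proof -
  obtain w where g: "g = prod_list (map sym_val w)" and w: "successively compat (p # map cls w)"
      "last (p # map cls w) = p"
    using assms unfolding sym_path_def by blast
  have cyc: "cyclic compat (map cls w)"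
    using w by (cases "w = []") (auto simp: cyclic_def successively_Cons)
  consider "w = []" | "w \<noteq> []" "\<forall>x\<in>set w. is_ltr x" | "\<forall>x\<in>set w. \<not> is_ltr x"
    | x y where "x \<in> set w" "is_ltr x" "y \<in> set w" "\<not> is_ltr y" by blast
  then show ?thesis
  proof cases
    case 1
    then have "same_curve g (zz ^ 0)" using g by simp
    then show ?thesis by blast
  next
    case 2
    then obtain s m where "w = map (Ltr s) m"
      using compat_all_Ltr cyc unfolding cyclic_def by blast
    with 2 have "g = zz powi 0 * of_word (map (ltr s) m)" "m \<noteq> []"
      using g sym_val_map_Ltr [of s m] by (auto simp: syl_def)
    then have "stable_curve (curve_of g)"
      unfolding stable_curve_def
      by (intro exI [of _ g] exI [of _ "[(0, map (ltr s) m)]"]) (auto simp: monotone_map_ltr)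
    then show ?thesis ..
  next
    case 3
    then obtain s n where w: "w = replicate n (Zed s)"
      using compat_all_Zed cyc unfolding cyclic_def by blast
    have "prod_list (map sym_val (replicate n (Zed s))) = zeta s ^ n"
      by (induction n) simp_all
    then have "g = zz ^ n \<or> g = inverse (zz ^ n)"
      using g w by (cases s) (auto simp: zeta_True zeta_False f2_inverse_power)
    then have "same_curve g (zz ^ n)"
      unfolding same_curve_def by (intro exI [of _ 1]) auto
    then show ?thesis by blast
  next
    case 4
    then obtain us vs where uv: "w = us @ vs" "\<not> is_ltr (hd (vs @ us))" "is_ltr (last (vs @ us))"
      using rotate_to_boundary [of x w is_ltr y] by blast
    have ne: "vs @ us \<noteq> []" using 4 uv by auto
    have "cyclic compat (map cls (vs @ us))"
      using cyc uv cyclic_rotate [of compat "map cls us" "map cls vs"] by simp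
    then have "stable_curve (curve_of (prod_list (map sym_val (vs @ us))))"
      using sym_word_factors [of "vs @ us"] factors_stable ne uv unfolding cyclic_def by blast
    moreover have "curve_of g = curve_of (prod_list (map sym_val (vs @ us)))"
      unfolding g uv(1) by (rule curve_prod_rotate)
    ultimately show ?thesis by simp
  qed
qed

section \<open>Balanced syllables\<close>

definition mixed :: "bool list \<Rightarrow> bool" where
  "mixed x \<longleftrightarrow> True \<in> set x \<and> False \<in> set x"

text \<open>Cutting at the first \<open>False\<close> and the last \<open>True\<close> isolates the
  end runs that the hat will rewrite; in the second case the two runs adjoin and share the cut
  letters.\<close>

lemma mixed_cases:
  assumes "mixed x"
  obtains k m l where "x = replicate k True @ False # m @ True # replicate l False"
  | k l where "x = replicate (Suc k) True @ replicate (Suc l) False"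
proof -
  obtain ys zs where x: "x = ys @ False # zs" "False \<notin> set ys"
    using assms split_list_first unfolding mixed_def by metis
  have ys: "ys = replicate (length ys) True"
    using x(2) by (intro replicate_eqI) (simp, metis (full_types))
  show ?thesis
  proof (cases "True \<in> set zs")
    case True
    then obtain m r where zs: "zs = m @ True # r" "True \<notin> set r"
      using split_list_last by metis
    have "r = replicate (length r) False"
      using zs(2) by (intro replicate_eqI) auto
    then show ?thesis using that(1) x(1) ys zs(1) by metis
  next
    case False
    then have zs: "zs = replicate (length zs) False"
      by (intro replicate_eqI) auto
    have "ys \<noteq> []" using assms x False unfolding mixed_def by auto
    then obtain k where "length ys = Suc k" by (cases ys) auto
    then have "x = replicate (Suc k) True @ replicate (Suc (length zs)) False"
      using x(1) ys zs by (metis replicate_Suc)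
    then show ?thesis using that(2) by blast
  qed
qed

text \<open>
  Inserting \<open>b B\<close> at each turn from negative to positive and \<open>A a\<close> at each turn from positive to
  negative replaces every syllable by its hat.
\<close>

definition hat :: "bool \<Rightarrow> bool list \<Rightarrow> f2" where
  "hat s x = gen (\<not> s) True * syl s x * gen (\<not> s) False"

text \<open>For positive sign this is \<open>B a^k b = (z^-1 a)^k\<close>, because
  \<open>z^-1 a = Bab\<close>.\<close>

lemma conj_True_run:
  "gen (\<not> s) True * syl s (replicate k True @ [False]) = (zeta s * gen s True) ^ k"
proof (induction k)
  case (Suc k)
  have *: "(zeta s * gen s True) ^ Suc k =
      zeta s * gen s True * (gen (\<not> s) True * syl s (replicate k True @ [False]))"
    by (simp only: Suc.IH power_Suc)
  show ?case
    unfolding * by (simp add: zeta_def mult.assoc)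
qed simp

text \<open>For positive sign this is \<open>a b^l A = (b z^-1)^l\<close>, because
  \<open>b z^-1 = abA\<close>.\<close>

lemma conj_False_run:
  "gen s True * syl s (replicate l False) * gen (\<not> s) False = (gen s False * zeta s) ^ l"
proof (induction l)
  case (Suc l)
  have *: "(gen s False * zeta s) ^ Suc l =
      gen s False * zeta s * (gen s True * syl s (replicate l False) * gen (\<not> s) False)"
    by (simp only: Suc.IH power_Suc)
  show ?case
    unfolding * by (simp add: zeta_def mult.assoc)
qed simp

lemma hat_separated:
  "hat s (replicate k True @ False # m @ True # replicate l False) =
    (zeta s * gen s True) ^ k * (syl s m * (gen s False * zeta s) ^ l)"
  unfolding hat_def conj_True_run [symmetric] conj_False_run [symmetric]
  by (simp add: mult.assoc)

text \<open>The last factor \<open>zeta s * gen s True\<close> from the initial run gives up its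
  letter to conjugate the final run, which leaves one \<open>zeta s\<close> in the middle.\<close>

lemma hat_overlapping:
  "hat s (replicate (Suc k) True @ replicate (Suc l) False) =
    (zeta s * gen s True) ^ k * (zeta s * (gen s False * zeta s) ^ l)"
proof -
  have "hat s (replicate (Suc k) True @ replicate (Suc l) False) =
      gen (\<not> s) True * syl s (replicate (Suc k) True @ [False]) *
        (syl s (replicate l False) * gen (\<not> s) False)"
    by (simp add: hat_def mult.assoc)
  also have "\<dots> = (zeta s * gen s True) ^ k * (zeta s * (gen s True *
      (syl s (replicate l False) * gen (\<not> s) False)))"
    by (simp only: conj_True_run power_Suc2 mult.assoc)
  finally show ?thesis
    unfolding conj_False_run [symmetric] by (simp only: mult.assoc)
qed

lemma sym_path_zeta: "p \<noteq> CZ (\<not> s) \<Longrightarrow> sym_path p (zeta s) (CZ s)"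
  using sym_path_sym [of p "Zed s"] by (cases p) auto

lemma sym_path_gen: "p \<noteq> CL (\<not> s) \<Longrightarrow> sym_path p (gen s i) (CL s)"
  using sym_path_sym [of p "Ltr s i"] by (cases p) auto

lemma sym_path_zeta_gen_power:
  "k = 0 \<or> p \<noteq> CZ (\<not> s) \<Longrightarrow>
    sym_path p ((zeta s * gen s i) ^ k) (if k = 0 then p else CL s)"
proof (induction k arbitrary: p)
  case (Suc k)
  have "sym_path p (zeta s * gen s i) (CL s)"
    using Suc.prems by (intro sym_path_trans [OF sym_path_zeta sym_path_gen]) auto
  moreover have "sym_path (CL s) ((zeta s * gen s i) ^ k) (CL s)"
    using Suc.IH [of "CL s"] by (auto split: if_splits)
  ultimately show ?case by (auto intro: sym_path_trans)
qed (simp add: sym_path_1)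

lemma sym_path_gen_zeta_power:
  "p \<noteq> CL (\<not> s) \<Longrightarrow>
    sym_path p ((gen s i * zeta s) ^ k) (if k = 0 then p else CZ s)"
proof (induction k arbitrary: p)
  case (Suc k)
  have "sym_path p (gen s i * zeta s) (CZ s)"
    using Suc.prems by (intro sym_path_trans [OF sym_path_gen sym_path_zeta]) auto
  moreover have "sym_path (CZ s) ((gen s i * zeta s) ^ k) (CZ s)"
    using Suc.IH [of "CZ s"] by (auto split: if_splits)
  ultimately show ?case by (auto intro: sym_path_trans)
qed (simp add: sym_path_1)

lemma sym_path_syl:
  "p \<noteq> CL (\<not> s) \<Longrightarrow> sym_path p (syl s m) (if m = [] then p else CL s)"
proof (induction m arbitrary: p)
  case (Cons i m)
  have "sym_path (CL s) (syl s m) (CL s)"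
    using Cons.IH [of "CL s"] by (auto split: if_splits)
  then show ?case
    using sym_path_gen [OF Cons.prems] by (auto intro: sym_path_trans)
qed (simp add: sym_path_1)

text \<open>A leading \<open>True\<close> makes the hat start with \<open>zeta s\<close>, a leading
  \<open>False\<close> with a letter of sign \<open>s\<close>. A final \<open>True\<close> makes it
  end in a letter, a final \<open>False\<close> in \<open>zeta s\<close>. The exception
  \<open>[False, True]\<close> has trivial hat and passes \<open>p\<close> on.\<close>

lemma sym_path_hat_mixed:
  assumes "mixed x" and p: "p \<noteq> (if hd x then CZ (\<not> s) else CL (\<not> s))"
  shows "sym_path p (hat s x)
    (if x = [False, True] then p else if last x then CL s else CZ s)"
  using assms(1)
proof (cases rule: mixed_cases)
  case (1 k m l)
  define p1 where "p1 = (if k = 0 then p else CL s)"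
  define p2 where "p2 = (if m = [] then p1 else CL s)"
  have "hd x \<longleftrightarrow> k \<noteq> 0" using 1 by (cases k) auto
  then have "sym_path p ((zeta s * gen s True) ^ k) p1" "p1 \<noteq> CL (\<not> s)"
    using p sym_path_zeta_gen_power [of k p s True] unfolding p1_def by (auto split: if_splits)
  moreover from this have "sym_path p1 (syl s m) p2" "p2 \<noteq> CL (\<not> s)"
    using sym_path_syl [of p1 s m] unfolding p2_def by auto
  moreover from this
  have "sym_path p2 ((gen s False * zeta s) ^ l) (if l = 0 then p2 else CZ s)"
    using sym_path_gen_zeta_power by blast
  ultimately have "sym_path p (hat s x) (if l = 0 then p2 else CZ s)"
    unfolding 1 hat_separated by (blast intro: sym_path_trans)
  moreover have "(if l = 0 then p2 else CZ s) =
      (if x = [False, True] then p else if last x then CL s else CZ s)"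
    unfolding 1 p1_def p2_def by (cases k; cases m; cases l) auto
  ultimately show ?thesis by simp
next
  case (2 k l)
  have "hd x" "\<not> last x" "x \<noteq> [False, True]" using 2 by auto
  then have "sym_path p ((zeta s * gen s True) ^ k) (if k = 0 then p else CL s)"
    using p sym_path_zeta_gen_power [of k p s True] by simp
  moreover have "sym_path (if k = 0 then p else CL s) (zeta s) (CZ s)"
    using p \<open>hd x\<close> by (intro sym_path_zeta) auto
  moreover have "sym_path (CZ s) ((gen s False * zeta s) ^ l) (CZ s)"
    using sym_path_gen_zeta_power [of "CZ s" s False l] by (auto split: if_splits)
  ultimately have "sym_path p (hat s x) (CZ s)"
    unfolding 2 hat_overlapping by (blast intro: sym_path_trans)
  then show ?thesis using \<open>\<not> last x\<close> \<open>x \<noteq> [False, True]\<close> by simp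
qed

section \<open>Cyclic words of alternating balanced syllables\<close>

type_synonym syllable = "bool \<times> bool list"

definition sval :: "syllable \<Rightarrow> f2" where
  "sval a = syl (fst a) (snd a)"

definition turn :: "syllable \<Rightarrow> syllable \<Rightarrow> bool" where
  "turn a b \<longleftrightarrow> fst a \<noteq> fst b \<and> last (snd a) = hd (snd b)"

definition balanced :: "bool \<Rightarrow> syllable \<Rightarrow> bool" where
  "balanced \<theta> a \<longleftrightarrow> mixed (snd a) \<or> snd a = [fst a = \<theta>]"

text \<open>
  The classes of symbols that may precede a turn leaving a syllable of sign \<open>s\<close> with the given last
  letter, when the hats of balanced syllables are spelled out as symbol words. A class other than
  that of the syllable itself occurs if the hat is empty or if the syllable is a single letter,
  whose hat is a letter of the opposite sign.
\<close>

fun ends :: "bool \<Rightarrow> bool \<Rightarrow> bool \<Rightarrow> sym_class set" where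
  "ends \<theta> s True = (if s = \<theta> then {p. p \<noteq> CZ s} else {CL s, CZ (\<not> s)})"
| "ends \<theta> s False = (if s = \<theta> then {CZ s} else {CZ s, CL (\<not> s)})"

definition out_class :: "syllable \<Rightarrow> sym_class" where
  "out_class a = (if mixed (snd a) then if last (snd a) then CL (fst a) else CZ (fst a)
     else CL (\<not> fst a))"

lemma out_class_ends:
  assumes "balanced \<theta> a"
  shows "out_class a \<in> ends \<theta> (fst a) (last (snd a))"
  using assms unfolding balanced_def out_class_def
  by (cases "last (snd a)") (auto simp: mixed_def)

text \<open>No class in \<open>ends\<close> clashes with the first symbol of the next hat. A
  non-empty hat forgets \<open>p\<close> and ends in \<open>out_class b\<close>; an empty one hands
  on \<open>p\<close>, which lies in \<open>ends\<close> for the next turn as well.\<close>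

lemma balanced_step:
  assumes "turn a b" "balanced \<theta> b" "p \<in> ends \<theta> (fst a) (last (snd a))"
  shows "snd b \<noteq> [False, True] \<Longrightarrow> sym_path p (hat (fst b) (snd b)) (out_class b)"
    and "\<exists>q \<in> ends \<theta> (fst b) (last (snd b)). sym_path p (hat (fst b) (snd b)) q"
proof -
  have p: "p \<in> ends \<theta> (\<not> fst b) (hd (snd b))"
    using assms(1,3) unfolding turn_def by simp
  have mixed: "sym_path p (hat (fst b) (snd b)) (if snd b = [False, True] then p else out_class b)"
    if "mixed (snd b)"
    using sym_path_hat_mixed [OF that, of p "fst b"] p that
    by (cases "hd (snd b)") (auto simp: out_class_def split: if_splits)
  have single: "sym_path p (hat (fst b) (snd b)) (out_class b)" if "\<not> mixed (snd b)"
  proof -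
    have b: "snd b = [fst b = \<theta>]" using assms(2) that unfolding balanced_def by blast
    \<comment> \<open>The single letter cancels one of the two letters inserted around it, as in
      \<open>B a A = B\<close>.\<close>
    have "hat (fst b) (snd b) = gen (\<not> fst b) (fst b = \<theta>)"
      unfolding b hat_def by (cases "fst b = \<theta>") (simp_all add: mult.assoc)
    moreover have "p \<noteq> CL (fst b)"
      using p unfolding b by (cases "fst b = \<theta>") (auto split: if_splits)
    ultimately show ?thesis
      using that sym_path_gen [of p "\<not> fst b"] by (simp add: out_class_def)
  qed
  show "sym_path p (hat (fst b) (snd b)) (out_class b)" if "snd b \<noteq> [False, True]"
    using that mixed single by fastforce
  show "\<exists>q \<in> ends \<theta> (fst b) (last (snd b)). sym_path p (hat (fst b) (snd b)) q"
  proof (cases "snd b = [False, True]")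
    case True
    then have "sym_path p (hat (fst b) (snd b)) p"
      using mixed by (simp add: mixed_def)
    moreover have "p \<in> ends \<theta> (fst b) (last (snd b))"
      using p True by (auto split: if_splits)
    ultimately show ?thesis by blast
  next
    case False
    then show ?thesis
      using mixed single out_class_ends [OF assms(2)] by fastforce
  qed
qed

definition hat_syl :: "syllable \<Rightarrow> f2" where
  "hat_syl a = hat (fst a) (snd a)"

lemma balanced_chain:
  "successively turn (a # ss) \<Longrightarrow> \<forall>b\<in>set ss. balanced \<theta> b \<Longrightarrow> p \<in> ends \<theta> (fst a) (last (snd a)) \<Longrightarrow>
    \<exists>q \<in> ends \<theta> (fst (last (a # ss))) (last (snd (last (a # ss)))).
      sym_path p (prod_list (map hat_syl ss)) q"
proof (induction ss arbitrary: a p)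
  case Nil
  then show ?case using sym_path_1 by auto
next
  case (Cons b ss)
  then obtain q where "q \<in> ends \<theta> (fst b) (last (snd b))" "sym_path p (hat_syl b) q"
    using balanced_step(2) [of a b \<theta> p] unfolding hat_syl_def by auto
  moreover from this Cons obtain r where
    "r \<in> ends \<theta> (fst (last (b # ss))) (last (snd (last (b # ss))))"
    "sym_path q (prod_list (map hat_syl ss)) r"
    by (metis list.set_intros(2) successively.simps(3))
  ultimately show ?case by (auto intro: sym_path_trans)
qed

lemma cyclic_mono:
  assumes "cyclic P xs" "\<And>x y. x \<in> set xs \<Longrightarrow> y \<in> set xs \<Longrightarrow> P x y \<Longrightarrow> Q x y"
  shows "cyclic Q xs"
proof -
  have "successively Q xs"
    using assms by (intro successively_mono [of P xs Q]) (auto simp: cyclic_def)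
  then show ?thesis using assms by (auto simp: cyclic_def)
qed

text \<open>The hats form a path of symbols. Started after a syllable \<open>d\<close> with
  non-empty hat, the path returns to \<open>out_class d\<close> whatever class it reaches before
  \<open>d\<close>, so it closes to a loop; being essential rules out a power of z.\<close>

theorem balanced_stable:
  assumes ss: "cyclic turn ss" "ss \<noteq> []" and bal: "\<forall>a\<in>set ss. balanced \<theta> a"
    and ess: "essential (curve_of (prod_list (map sval ss)))"
  shows "stable_curve (curve_of (prod_list (map sval ss)))"
proof -
  \<comment> \<open>Two such syllables cannot meet at a turn, since the last bit \<open>True\<close>
    differs from the first bit \<open>False\<close>.\<close>
  have "\<exists>d\<in>set ss. snd d \<noteq> [False, True]"
  proof (rule ccontr)
    assume "\<not> ?thesis"
    then have "snd (hd ss) = [False, True]" "snd (last ss) = [False, True]"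
      using ss(2) by auto
    then show False
      using ss unfolding cyclic_def turn_def by auto
  qed
  then obtain us d vs where split: "ss = us @ d # vs" and d: "snd d \<noteq> [False, True]"
    by (metis split_list)
  define ts where "ts = vs @ us"
  have cyc: "cyclic turn (d # ts)"
    using ss(1) cyclic_rotate [of turn us "d # vs"] unfolding split ts_def by simp
  have d_out: "out_class d \<in> ends \<theta> (fst d) (last (snd d))"
    using out_class_ends bal split by simp
  have "\<forall>b\<in>set ts. balanced \<theta> b" using bal unfolding split ts_def by auto
  then obtain q where q: "q \<in> ends \<theta> (fst (last (d # ts))) (last (snd (last (d # ts))))"
      "sym_path (out_class d) (prod_list (map hat_syl ts)) q"
    using balanced_chain [of d ts \<theta> "out_class d"] cyc d_out unfolding cyclic_def by blast
  have "turn (last (d # ts)) d" "balanced \<theta> d"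
    using cyc bal split unfolding cyclic_def by auto
  then have "sym_path q (hat_syl d) (out_class d)"
    unfolding hat_syl_def using balanced_step(1) q(1) d by blast
  then have loop: "sym_path (out_class d) (prod_list (map hat_syl (ts @ [d]))) (out_class d)"
    using sym_path_trans [OF q(2)] by simp
  have "curve_of (prod_list (map sval ss)) = curve_of (prod_list (map hat_syl ss))"
  proof (rule telescope_curve)
    show "sval a = gen (fst a) False * hat_syl a * gen (fst a) True" for a
      unfolding sval_def hat_syl_def hat_def by (simp add: mult.assoc)
    show "cyclic (\<lambda>a b. gen (fst a) True * gen (fst b) False = 1) ss"
      using ss(1) by (rule cyclic_mono) (auto simp: turn_def)
  qed
  also have "\<dots> = curve_of (prod_list (map hat_syl (d # ts)))"
    using curve_prod_rotate [of hat_syl us "d # vs"] unfolding split ts_def by simp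
  also have "\<dots> = curve_of (prod_list (map hat_syl (ts @ [d])))"
    using curve_prod_rotate [of hat_syl "[d]" ts] by simp
  finally show ?thesis
    using sym_path_loop [OF loop] ess essential_iff by auto
qed


section \<open>Twists acting on syllables\<close>

text \<open>The bit \<open>p\<close> is the one fixed by the twist on syllables of the given sign;
  for either twist and either sign the other bit expands to \<open>[True, False]\<close>.\<close>

fun subst_bit :: "bool \<Rightarrow> bool \<Rightarrow> bool list" where
  "subst_bit p i = (if i = p then [i] else [True, False])"

text \<open>Syllable image after cancellation at the turns: with \<open>p\<close> every non-empty
  image starts with \<open>True\<close> and loses it, otherwise it ends with \<open>False\<close>
  and loses that.\<close>

definition trim :: "bool \<Rightarrow> bool list \<Rightarrow> bool list" where
  "trim p x = (if p then tl else butlast) (concat (map (subst_bit p) x))"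

lemma trim_Nil [simp]: "trim p [] = []"
  by (simp add: trim_def)

lemma trim_True_Cons: "trim True (i # y) = (if i then [] else [False]) @ concat (map (subst_bit True) y)"
  by (simp add: trim_def)

lemma trim_False_snoc: "trim False (y @ [i]) = concat (map (subst_bit False) y) @ (if i then [True] else [])"
  by (simp add: trim_def butlast_append)

lemma trim_singleton: "trim p [i] = (if i = p then [] else [i])"
  by (cases p) (auto simp: trim_def)

lemma twist_syl: "twist_f2 t (syl s x) = syl s (concat (map (subst_bit (s = (t = L))) x))"
proof -
  have "twist_letter t (ltr s i) = map (ltr s) (subst_bit (s = (t = L)) i)" for i
    by (cases t; cases s; cases i) auto
  then have "twist_word t (map (ltr s) x) = map (ltr s) (concat (map (subst_bit (s = (t = L))) x))"
    by (induction x) (auto simp: twist_word_def simp del: subst_bit.simps)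
  then show ?thesis
    unfolding syl_def twist_of_word by simp
qed

lemma concat_subst_True: "x \<noteq> [] \<Longrightarrow> concat (map (subst_bit True) x) = True # trim True x"
  by (cases x) (auto simp: trim_def)

lemma concat_subst_False: "x \<noteq> [] \<Longrightarrow> concat (map (subst_bit False) x) = trim False x @ [False]"
  by (cases x rule: rev_cases) (auto simp: trim_False_snoc)

text \<open>With \<open>last_trim\<close>, this keeps the turns reduced after a twist as long as no
  syllable vanishes.\<close>

lemma hd_trim:
  assumes "trim p x \<noteq> []" shows "hd (trim p x) = hd x"
proof (cases p)
  case True
  obtain i y where x: "x = i # y" using assms by (cases x) auto
  with assms True show ?thesis
    by (cases "y = []") (auto simp: trim_True_Cons concat_subst_True simp del: subst_bit.simps)
next
  case False
  then have "x \<noteq> []" using assms by auto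
  then have "hd (concat (map (subst_bit False) x)) = hd x" by (cases x) auto
  then show ?thesis using assms False \<open>x \<noteq> []\<close> by (simp add: concat_subst_False)
qed

lemma last_trim:
  assumes "trim p x \<noteq> []" shows "last (trim p x) = last x"
proof (cases p)
  case False
  then obtain i y where x: "x = y @ [i]" using assms by (cases x rule: rev_cases) auto
  with assms False show ?thesis
    by (cases "y = []")
      (auto simp: trim_singleton trim_False_snoc concat_subst_False
        simp del: subst_bit.simps split: if_splits)
next
  case True
  then have "x \<noteq> []" using assms by auto
  then have "last (concat (map (subst_bit True) x)) = last x"
    by (cases x rule: rev_cases) auto
  then show ?thesis using assms True \<open>x \<noteq> []\<close> by (simp add: concat_subst_True)
qed

definition weight :: "bool list \<Rightarrow> nat" where
  "weight x = (if mixed x then 0 else length x)"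

lemma mixed_trim:
  assumes "mixed x" shows "mixed (trim p x)"
proof (cases p)
  case True
  obtain i y where x: "x = i # y" "y \<noteq> []"
    using assms by (cases x; cases "tl x") (auto simp: mixed_def)
  have "True \<in> set (trim True x)"
    using x by (simp add: trim_True_Cons concat_subst_True del: subst_bit.simps)
  moreover have "False \<in> set (trim True x)"
    using assms x by (cases i) (auto simp: trim_True_Cons mixed_def)
  ultimately show ?thesis using True by (simp add: mixed_def)
next
  case False
  obtain i y where x: "x = y @ [i]" "y \<noteq> []"
    using assms by (cases x rule: rev_cases; cases "butlast x") (auto simp: mixed_def)
  have "False \<in> set (trim False x)"
    using x by (simp add: trim_False_snoc concat_subst_False del: subst_bit.simps)
  moreover have "True \<in> set (trim False x)"
    using assms x by (cases i) (auto simp: trim_False_snoc mixed_def)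
  ultimately show ?thesis using False by (simp add: mixed_def)
qed

lemma not_mixed_replicate:
  assumes "\<not> mixed x" "x \<noteq> []"
  obtains n i where "x = replicate (Suc n) i"
proof -
  have "y = hd x" if "y \<in> set x" for y
    using that assms(1) hd_in_set [OF assms(2)] unfolding mixed_def
    by (metis (full_types))
  then have "x = replicate (length x) (hd x)"
    by (intro replicate_eqI) auto
  moreover obtain n where "length x = Suc n" using assms(2) by (cases x) auto
  ultimately show ?thesis using that by metis
qed

text \<open>A power of the fixed letter loses one letter. A power of the other letter has length at
  least two here, and its trimmed image contains both bits, so the weight drops to 0.\<close>

lemma weight_trim_less:
  assumes "\<not> mixed x" "x \<noteq> []" "x \<noteq> [\<not> p]"
  shows "weight (trim p x) < weight x"
proof -
  obtain n i where x: "x = replicate (Suc n) i"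
    using assms not_mixed_replicate by blast
  have not_mixed: "\<not> mixed (replicate k j)" for k j
    by (cases j) (auto simp: mixed_def)
  show ?thesis
  proof (cases "i = p")
    case True
    have "concat (map (subst_bit p) (replicate k p)) = replicate k p" for k
      by (induction k) auto
    moreover have "tl (replicate (Suc n) p) = replicate n p"
      by simp
    moreover have "butlast (replicate (Suc n) p) = replicate n p"
      unfolding replicate_Suc by (simp flip: replicate_append_same)
    ultimately have "trim p x = replicate n p"
      unfolding x True trim_def by presburger
    then show ?thesis
      unfolding x weight_def using not_mixed not_mixed [of "Suc n" i] by auto
  next
    case False
    then obtain m where m: "n = Suc m" using assms(3) x by (cases n) auto
    have "mixed (trim p x)"
    proof (cases p)
      case True
      then show ?thesis using False x m by (auto simp: trim_True_Cons mixed_def)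
    next
      case p: False
      have "x = (i # replicate m i) @ [i]" using x m by (simp add: replicate_append_same)
      then show ?thesis using False p trim_False_snoc [of "i # replicate m i" i]
        by (auto simp: mixed_def)
    qed
    then show ?thesis
      unfolding x weight_def using not_mixed [of "Suc n" i] by simp
  qed
qed

lemma weight_trim_le:
  assumes "x \<noteq> []" shows "weight (trim p x) \<le> weight x"
proof -
  consider "mixed x" | "x = [\<not> p]" | "\<not> mixed x" "x \<noteq> [\<not> p]" by blast
  then show ?thesis
  proof cases
    case 1
    then show ?thesis using mixed_trim by (simp add: weight_def)
  next
    case 2
    then show ?thesis by (simp add: trim_singleton)
  next
    case 3
    then show ?thesis using assms weight_trim_less less_imp_le by blast
  qed
qed

section \<open>Twists of whole syllable lists\<close>

definition twist_syllable :: "twist \<Rightarrow> syllable \<Rightarrow> syllable" where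
  "twist_syllable t a = (fst a, trim (fst a = (t = L)) (snd a))"

lemma twist_prod_list: "twist_f2 t (prod_list (map f xs)) = prod_list (map (\<lambda>x. twist_f2 t (f x)) xs)"
  by (induction xs) (auto simp: twist_f2_mult)

lemma twist_syllables:
  assumes "cyclic turn ss" "\<forall>a\<in>set ss. snd a \<noteq> []"
  shows "twist_curve t (curve_of (prod_list (map sval ss))) =
    curve_of (prod_list (map sval (map (twist_syllable t) ss)))"
proof -
  let ?\<theta> = "t = L"
  \<comment> \<open>The letters removed by \<open>trim\<close>: the first one for syllables of sign
    \<open>?\<theta>\<close>, the last one for the others. They cancel at turns into sign
    \<open>?\<theta>\<close>.\<close>
  let ?l = "\<lambda>a. if fst a = ?\<theta> then gen ?\<theta> True else 1"
  let ?r = "\<lambda>a. if fst a = ?\<theta> then 1 else gen (\<not> ?\<theta>) False"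
  have "curve_of (prod_list (map (\<lambda>a. twist_f2 t (sval a)) ss)) =
      curve_of (prod_list (map (\<lambda>a. sval (twist_syllable t a)) ss))"
  proof (rule telescope_curve)
    show "cyclic (\<lambda>a b. ?r a * ?l b = 1) ss"
      using assms(1) by (rule cyclic_mono) (auto simp: turn_def)
    show "twist_f2 t (sval a) = ?l a * sval (twist_syllable t a) * ?r a" if "a \<in> set ss" for a
    proof (cases "fst a = ?\<theta>")
      case True
      with that assms(2) show ?thesis
        by (simp add: sval_def twist_syllable_def twist_syl concat_subst_True del: subst_bit.simps)
    next
      case False
      then have "(fst a = ?\<theta>) = False" "fst a = (\<not> ?\<theta>)" by auto
      with that assms(2) show ?thesis
        by (simp add: sval_def twist_syllable_def twist_syl concat_subst_False del: subst_bit.simps)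
    qed
  qed
  then show ?thesis
    by (simp add: twist_curve_curve_of twist_prod_list comp_def)
qed

lemma cyclic_turn_twist:
  assumes "cyclic turn ss" "\<forall>a\<in>set (map (twist_syllable t) ss). snd a \<noteq> []"
  shows "cyclic turn (map (twist_syllable t) ss)"
proof -
  have "cyclic (\<lambda>a b. turn (twist_syllable t a) (twist_syllable t b)) ss"
    using assms(1)
  proof (rule cyclic_mono)
    show "turn (twist_syllable t a) (twist_syllable t b)" if "a \<in> set ss" "b \<in> set ss" "turn a b" for a b
      using that assms(2) by (auto simp: turn_def twist_syllable_def hd_trim last_trim)
  qed
  then show ?thesis
    by (auto simp: cyclic_def successively_map hd_map last_map)
qed

text \<open>The single letters that \<open>t\<close> leaves unchanged are those balanced for
  \<open>\<theta>\<close>, so an unbalanced syllable loses weight and no other gains any.\<close>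

lemma sum_list_weight_twist_less:
  assumes "\<not> (\<forall>a\<in>set ss. balanced \<theta> a)" "\<forall>a\<in>set ss. snd a \<noteq> []" "\<theta> \<noteq> (t = L)"
  shows "(\<Sum>a\<leftarrow>map (twist_syllable t) ss. weight (snd a)) < (\<Sum>a\<leftarrow>ss. weight (snd a))"
proof -
  obtain d where d: "d \<in> set ss" "\<not> balanced \<theta> d" using assms(1) by blast
  then obtain us vs where ss: "ss = us @ d # vs" by (metis split_list)
  have "weight (snd (twist_syllable t d)) < weight (snd d)"
    unfolding twist_syllable_def snd_conv
    by (rule weight_trim_less) (use d assms(2,3) in \<open>auto simp: balanced_def\<close>)
  moreover have le: "weight (snd (twist_syllable t a)) \<le> weight (snd a)" if "a \<in> set ss" for a
    using that assms(2) by (simp add: twist_syllable_def weight_trim_le)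
  have "(\<Sum>a\<leftarrow>xs. weight (snd (twist_syllable t a))) \<le> (\<Sum>a\<leftarrow>xs. weight (snd a))"
    if "set xs \<subseteq> set ss" for xs
    using that le by (intro sum_list_mono) blast
  from this [of us] this [of vs] have
    "(\<Sum>a\<leftarrow>us. weight (snd (twist_syllable t a))) \<le> (\<Sum>a\<leftarrow>us. weight (snd a))"
    "(\<Sum>a\<leftarrow>vs. weight (snd (twist_syllable t a))) \<le> (\<Sum>a\<leftarrow>vs. weight (snd a))"
    unfolding ss by auto
  ultimately show ?thesis unfolding ss by (simp add: comp_def)
qed

section \<open>Finiteness of the unstable part\<close>

definition unstable :: "curve \<Rightarrow> twist list set" where
  "unstable \<gamma> = {v. \<not> stable_curve (label \<gamma> v)}"

lemma stable_curve_label: "stable_curve \<gamma> \<Longrightarrow> stable_curve (label \<gamma> v)"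
  by (induction v) (auto simp: label_def stable_curve_twist)

lemma unstable_stable: "stable_curve \<gamma> \<Longrightarrow> unstable \<gamma> = {}"
  by (simp add: unstable_def stable_curve_label)

text \<open>The last list entry acts first, so the vertices other than the root split by that entry
  into the trees of the two children.\<close>

lemma finite_unstable_step:
  assumes "\<And>t. finite (unstable (twist_curve t \<gamma>))"
  shows "finite (unstable \<gamma>)"
proof (rule finite_subset)
  show "unstable \<gamma> \<subseteq> {[]} \<union> (\<Union>t\<in>{L, R}. (\<lambda>v. v @ [t]) ` unstable (twist_curve t \<gamma>))"
  proof
    fix v assume v: "v \<in> unstable \<gamma>"
    show "v \<in> {[]} \<union> (\<Union>t\<in>{L, R}. (\<lambda>v. v @ [t]) ` unstable (twist_curve t \<gamma>))"
    proof (cases v rule: rev_cases)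
      case (snoc u t)
      then have "u \<in> unstable (twist_curve t \<gamma>)"
        using v by (simp add: unstable_def label_def)
      then show ?thesis using snoc by (cases t) auto
    qed simp
  qed
qed (use assms in simp)

section \<open>Induction on syllable lists\<close>

definition reduced :: "syllable list \<Rightarrow> bool" where
  "reduced ss \<longleftrightarrow> cyclic turn ss \<and> (\<forall>a\<in>set ss. snd a \<noteq> [])"

lemma drop_empty_syllables:
  assumes "\<not> (\<forall>a\<in>set ss. snd a \<noteq> [])"
  obtains ss' where "length ss' < length ss" "prod_list (map sval ss') = prod_list (map sval ss)"
proof -
  obtain a where "a \<in> set ss" "\<not> snd a \<noteq> []" using assms by blast
  then have "length (filter (\<lambda>a. snd a \<noteq> []) ss) < length ss"
    by (rule length_filter_less)
  moreover have "prod_list (map sval (filter (\<lambda>a. snd a \<noteq> []) ss)) = prod_list (map sval ss)"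
    by (induction ss) (auto simp: sval_def)
  ultimately show ?thesis by (rule that)
qed

text \<open>
  Non-reduced lists come above reduced ones of the same length: cancellation may turn a mixed
  syllable into a non-mixed one and so increase the weight.
\<close>

definition syl_measure :: "(syllable list \<times> syllable list) set" where
  "syl_measure = measures [length, \<lambda>ss. if reduced ss then 0 else 1,
    \<lambda>ss. if reduced ss then \<Sum>a\<leftarrow>ss. weight (snd a) else \<Sum>a\<leftarrow>ss. length (snd a)]"

lemma wf_syl_measure: "wf syl_measure"
  unfolding syl_measure_def by (rule wf_measures)

text \<open>Without changing the curve, empty syllables are dropped and bad turns merged or
  cancelled. A reduced list is either stable or has two children of smaller measure, and finiteness
  passes from them to their parent.\<close>

lemma finite_unstable_syllables:
  "essential (curve_of (prod_list (map sval ss))) \<Longrightarrow>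
    finite (unstable (curve_of (prod_list (map sval ss))))"
proof (induction ss rule: wf_induct_rule [OF wf_syl_measure])
  case (1 ss)
  let ?c = "\<lambda>ss. curve_of (prod_list (map sval ss))"
  note IH = 1(1) and ess = 1(2)
  have shorter: "finite (unstable (?c ts))" if "length ts < length ss" "essential (?c ts)" for ts
    using that by (intro IH) (auto simp: syl_measure_def)
  show ?case
  proof (cases "\<forall>a\<in>set ss. snd a \<noteq> []")
    case False
    then obtain ts where "length ts < length ss" "prod_list (map sval ts) = prod_list (map sval ss)"
      by (rule drop_empty_syllables)
    then show ?thesis using shorter ess by metis
  next
    case nonempty: True
    consider "ss = []" | a where "ss = [a]" | "length ss \<ge> 2" "\<not> cyclic turn ss"
      | "ss \<noteq> []" "reduced ss"
      using nonempty unfolding reduced_def by (cases ss; cases "tl ss") auto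
    then show ?thesis
    proof cases
      case 1
      then show ?thesis
        using ess essential_iff [of 1] same_curve_refl [of 1]
        by (metis list.map(1) power_0 prod_list.Nil)
    next
      case (2 a)
      have "stable_curve (?c ss)"
        unfolding stable_curve_def
        by (intro exI [of _ "sval a"] exI [of _ "[(0, map (ltr (fst a)) (snd a))]"])
          (use 2 nonempty in \<open>auto simp: sval_def syl_def monotone_map_ltr\<close>)
      then show ?thesis by (simp add: unstable_stable)
    next
      case 3
      then obtain us vs a b zs where split: "ss = us @ vs" "vs @ us = a # b # zs" "\<not> turn a b"
        using not_cyclic_rotation by blast
      have curve: "?c (a # b # zs) = ?c ss"
        unfolding split(1) split(2) [symmetric] by (rule curve_prod_rotate)
      have len: "length (a # b # zs) = length ss"
        "(\<Sum>a\<leftarrow>a # b # zs. length (snd a)) = (\<Sum>a\<leftarrow>ss. length (snd a))"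
        unfolding split(1) split(2) [symmetric] by simp_all
      have "set ss = set (a # b # zs)" unfolding split(1) split(2) [symmetric] by auto
      then have ne: "snd a \<noteq> []" "snd b \<noteq> []" using nonempty by auto
      show ?thesis
      proof (cases "fst a = fst b")
        case True
        have "?c ((fst a, snd a @ snd b) # zs) = ?c (a # b # zs)"
          using True by (simp add: sval_def mult.assoc)
        then show ?thesis
          using shorter [of "(fst a, snd a @ snd b) # zs"] len(1) curve ess by simp
      next
        case False
        then have "last (snd a) \<noteq> hd (snd b)" using split(3) unfolding turn_def by simp
        then have cancel: "gen (fst a) (last (snd a)) * gen (fst b) (hd (snd b)) = 1"
          using False by simp
        \<comment> \<open>An emptied syllable is kept in the list, so the number of syllables stays
          the same. The measure drops either because \<open>ts\<close> is now reduced or because it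
          has fewer letters.\<close>
        define ts where "ts = (fst a, butlast (snd a)) # (fst b, tl (snd b)) # zs"
        have "sval a = syl (fst a) (butlast (snd a)) * gen (fst a) (last (snd a))"
          unfolding sval_def using ne(1) syl_simps(3) [of "fst a" "butlast (snd a)" "[last (snd a)]"]
          by simp
        moreover have "sval b = gen (fst b) (hd (snd b)) * syl (fst b) (tl (snd b))"
          unfolding sval_def using ne(2) by (cases "snd b") auto
        ultimately have "prod_list (map sval (a # b # zs)) = prod_list (map sval ts)"
          using cancel by (simp add: ts_def sval_def mult.assoc)
        then have ts: "?c ts = ?c ss" using curve by simp
        have "length ts = length ss" using len(1) by (simp add: ts_def)
        moreover have "(\<Sum>a\<leftarrow>ts. length (snd a)) < (\<Sum>a\<leftarrow>ss. length (snd a))"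
          using len(2) ne by (cases "snd a"; cases "snd b") (auto simp: ts_def)
        moreover have "\<not> reduced ss" using 3 unfolding reduced_def by simp
        ultimately show ?thesis
          using IH [of ts] ess ts by (auto simp: syl_measure_def)
      qed
    next
      case 4
      show ?thesis
      proof (cases "stable_curve (?c ss)")
        case True
        then show ?thesis by (simp add: unstable_stable)
      next
        case False
        show ?thesis
        proof (rule finite_unstable_step)
          fix t
          define ts where "ts = map (twist_syllable t) ss"
          have ts: "twist_curve t (?c ss) = ?c ts"
            unfolding ts_def using twist_syllables 4 unfolding reduced_def by blast
          have ess_ts: "essential (?c ts)"
            using essential_twist ess ts by (metis twist_curve_curve_of)
          have len: "length ts = length ss" by (simp add: ts_def)
          have "finite (unstable (?c ts))"
          proof (cases "\<forall>a\<in>set ts. snd a \<noteq> []")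
            case empty: False
            then obtain us where "length us < length ts"
              "prod_list (map sval us) = prod_list (map sval ts)"
              by (rule drop_empty_syllables)
            then show ?thesis using shorter [of us] ess_ts len by simp
          next
            case True
            then have "reduced ts"
              using 4 cyclic_turn_twist unfolding reduced_def ts_def by blast
            \<comment> \<open>Instability excludes balance for both values of
              \<open>\<theta>\<close>; the value matching \<open>t\<close> makes this twist lower
              the weight.\<close>
            moreover have "\<not> (\<forall>a\<in>set ss. balanced (t \<noteq> L) a)"
              using balanced_stable 4 ess False unfolding reduced_def by blast
            then have "(\<Sum>a\<leftarrow>ts. weight (snd a)) < (\<Sum>a\<leftarrow>ss. weight (snd a))"
              unfolding ts_def
              by (rule sum_list_weight_twist_less) (use 4 in \<open>auto simp: reduced_def\<close>)
            ultimately show ?thesis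
              using 4 len ess_ts by (intro IH) (auto simp: syl_measure_def)
          qed
          then show "finite (unstable (twist_curve t (?c ss)))"
            using ts by simp
        qed
      qed
    qed
  qed
qed

lemma of_word_syllables: "\<exists>ss. of_word w = prod_list (map sval ss)"
proof (induction w)
  case (Cons x w)
  then obtain ss where ss: "of_word w = prod_list (map sval ss)" ..
  obtain s i where "x = ltr s i"
    using ltr.simps by (cases x) metis+
  then have "of_word (x # w) = prod_list (map sval ((s, [i]) # ss))"
    by (simp add: of_word_Cons [of _ w] ss sval_def gen_def)
  then show ?case by (intro exI)
qed (rule exI [of _ "[]"], simp)

lemma curve_of_exhaust: "\<exists>g. \<gamma> = curve_of g"
  unfolding curve_of_def by (rule exI [of _ "rep_curve \<gamma>"]) (simp add: Quotient3_abs_rep [OF Quotient3_curve])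

lemma finite_unstable:
  assumes "essential \<gamma>" shows "finite (unstable \<gamma>)"
proof -
  obtain g where "\<gamma> = curve_of g"
    using curve_of_exhaust by blast
  moreover obtain w where "g = of_word w"
    using of_word_exhaust by blast
  moreover obtain ss where "of_word w = prod_list (map sval ss)"
    using of_word_syllables [of w] ..
  ultimately show ?thesis
    using assms finite_unstable_syllables [of ss] by simp
qed

section \<open>Decomposition of the tree\<close>

lemma label_Cons: "label \<gamma> (t # v) = twist_curve t (label \<gamma> v)"
  by (simp add: label_def)

lemma unstable_tl: "t # v \<in> unstable \<gamma> \<Longrightarrow> v \<in> unstable \<gamma>"
  using stable_curve_twist [of "label \<gamma> v" t] by (auto simp: unstable_def label_Cons)

lemma unstable_suffix: "w @ v \<in> unstable \<gamma> \<Longrightarrow> v \<in> unstable \<gamma>"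
proof (induction w)
  case (Cons t w)
  then show ?case using unstable_tl [of t "w @ v"] by simp
qed simp

lemma child_iff: "child v v' \<longleftrightarrow> (\<exists>t. v' = t # v)"
proof
  assume "\<exists>t. v' = t # v"
  then obtain t where "v' = t # v" ..
  then show "child v v'" by (cases t) (simp_all add: child_def)
qed (auto simp: child_def)

section \<open>Descendants of minimal stable vertices\<close>

definition descendants :: "twist list \<Rightarrow> twist list set" where
  "descendants m = range (\<lambda>w. w @ m)"

definition stable_roots :: "curve \<Rightarrow> twist list set" where
  "stable_roots \<gamma> = {m. m \<notin> unstable \<gamma> \<and> (\<forall>t u. m = t # u \<longrightarrow> u \<in> unstable \<gamma>)}"

lemma finite_stable_roots:
  assumes "finite (unstable \<gamma>)" shows "finite (stable_roots \<gamma>)"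
proof (rule finite_subset)
  show "stable_roots \<gamma> \<subseteq> {[]} \<union> (\<Union>t\<in>{L, R}. (#) t ` unstable \<gamma>)"
  proof
    show "m \<in> {[]} \<union> (\<Union>t\<in>{L, R}. (#) t ` unstable \<gamma>)" if "m \<in> stable_roots \<gamma>" for m
    proof (cases m)
      case (Cons t u)
      then show ?thesis using that by (cases t) (auto simp: stable_roots_def)
    qed simp
  qed
qed (use assms in simp)

text \<open>Climb from \<open>v\<close> to its parent until the parent is unstable or the root of
  the tree is reached.\<close>

lemma stable_root_exists: "v \<notin> unstable \<gamma> \<Longrightarrow> \<exists>m\<in>stable_roots \<gamma>. v \<in> descendants m"
proof (induction v)
  case Nil
  then have "[] \<in> stable_roots \<gamma>" by (simp add: stable_roots_def)
  then show ?case by (auto simp: descendants_def)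
next
  case (Cons t v)
  show ?case
  proof (cases "v \<in> unstable \<gamma>")
    case True
    with Cons.prems have "t # v \<in> stable_roots \<gamma>" by (simp add: stable_roots_def)
    moreover have "t # v \<in> descendants (t # v)"
      unfolding descendants_def by (rule range_eqI [of _ _ "[]"]) simp
    ultimately show ?thesis by blast
  next
    case False
    then obtain m w where "m \<in> stable_roots \<gamma>" "v = w @ m"
      using Cons.IH unfolding descendants_def by blast
    moreover from this have "t # v \<in> descendants m"
      unfolding descendants_def by (intro range_eqI [of _ _ "t # w"]) simp
    ultimately show ?thesis by blast
  qed
qed

lemma descendants_stable: "m \<in> stable_roots \<gamma> \<Longrightarrow> descendants m \<inter> unstable \<gamma> = {}"
  unfolding descendants_def stable_roots_def using unstable_suffix by blast

text \<open>If \<open>m\<close> were a proper descendant of \<open>m'\<close>, its unstable parent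
  would still descend from the stable vertex \<open>m'\<close>.\<close>

lemma stable_roots_suffix:
  assumes "m \<in> stable_roots \<gamma>" "w @ m' = m" "m' \<in> stable_roots \<gamma>"
  shows "m = m'"
proof (cases w)
  case (Cons t u)
  then have "u @ m' \<in> unstable \<gamma>"
    using assms(1,2) unfolding stable_roots_def by auto
  then show ?thesis
    using assms(3) unstable_suffix unfolding stable_roots_def by blast
qed (use assms in simp)

text \<open>Two ancestors of one vertex are suffixes of the same list, so one of them is a suffix of
  the other.\<close>

lemma disjoint_stable_roots:
  assumes "m \<in> stable_roots \<gamma>" "m' \<in> stable_roots \<gamma>" "v \<in> descendants m" "v \<in> descendants m'"
  shows "m = m'"
proof -
  obtain w w' where "w @ m = w' @ m'"
    using assms(3,4) unfolding descendants_def by auto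
  then obtain u where "u @ m = m' \<or> u @ m' = m"
    by (auto simp: append_eq_append_conv2)
  then show ?thesis
    using assms(1,2) stable_roots_suffix by metis
qed

lemma forward_complete_descendants: "forward_complete (descendants m)"
  unfolding forward_complete_def child_iff
proof (intro ballI allI impI, elim exE)
  fix v v' t assume "v \<in> descendants m" "v' = t # v"
  then obtain w where "v' = (t # w) @ m" unfolding descendants_def by auto
  then show "v' \<in> descendants m" unfolding descendants_def by blast
qed

lemma subtree_descendants: "subtree (descendants m)"
proof -
  let ?E = "{(x, y). x \<in> descendants m \<and> y \<in> descendants m \<and> (child x y \<or> child y x)}"
  have "sym ?E" by (auto intro: symI)
  then have sym: "sym (?E\<^sup>*)" by (rule sym_rtrancl)
  have from_root: "(m, w @ m) \<in> ?E\<^sup>*" for w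
  proof (induction w)
    case (Cons t w)
    have "(w @ m, (t # w) @ m) \<in> ?E"
      unfolding descendants_def child_iff by auto
    with Cons.IH show ?case by (rule rtrancl_into_rtrancl)
  qed simp
  have "(u, v) \<in> ?E\<^sup>*" if "u \<in> descendants m" "v \<in> descendants m" for u v
  proof -
    have "(m, u) \<in> ?E\<^sup>*" "(m, v) \<in> ?E\<^sup>*"
      using that from_root unfolding descendants_def by auto
    then show ?thesis using sym by (meson rtrancl_trans symD)
  qed
  moreover have "descendants m \<noteq> {}" by (simp add: descendants_def)
  ultimately show ?thesis unfolding subtree_def by blast
qed

text \<open>A path inside a larger stable subtree could leave the descendants of \<open>m\<close>
  only through the parent of \<open>m\<close>, which is unstable.\<close>

lemma maximal_descendants:
  assumes m: "m \<in> stable_roots \<gamma>"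
  shows "maximal_stable_subtree \<gamma> (descendants m)"
  unfolding maximal_stable_subtree_def
proof (intro conjI allI impI)
  show "stable_subtree \<gamma> (descendants m)"
    using subtree_descendants descendants_stable [OF m]
    unfolding stable_subtree_def unstable_def by blast
  fix S assume "stable_subtree \<gamma> S \<and> descendants m \<subseteq> S"
  then have S: "subtree S" "S \<inter> unstable \<gamma> = {}" "descendants m \<subseteq> S"
    unfolding stable_subtree_def unstable_def by auto
  let ?E = "{(x, y). x \<in> S \<and> y \<in> S \<and> (child x y \<or> child y x)}"
  have root: "m \<in> descendants m"
    unfolding descendants_def by (rule range_eqI [of _ _ "[]"]) simp
  have "v \<in> descendants m" if "v \<in> S" for v
  proof -
    have "(m, v) \<in> ?E\<^sup>*"
      using S root that unfolding subtree_def by blast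
    then show ?thesis
    proof (induction rule: rtrancl_induct)
      case (step x y)
      show ?case
      proof (cases "child x y")
        case True
        then show ?thesis
          using step.IH forward_complete_descendants unfolding forward_complete_def by blast
      next
        case False
        then obtain t where x: "x = t # y"
          using step.hyps(2) unfolding child_iff by blast
        obtain w where w: "t # y = w @ m"
          using step.IH x unfolding descendants_def by auto
        have "y \<notin> unstable \<gamma>" using step.hyps(2) S(2) by blast
        then have "w \<noteq> []" using w m unfolding stable_roots_def by auto
        then have "y = tl w @ m" using w by (cases w) auto
        then show ?thesis unfolding descendants_def by blast
      qed
    qed (rule root)
  qed
  then show "S = descendants m" using S(3) by blast
qed

theorem corollary1p6:
  fixes \<gamma> :: curve
  assumes "essential \<gamma>"
  shows "\<exists>(N :: twist list set) (\<S> :: twist list set set).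
    finite N \<and> (\<forall>v\<in>N. \<not> stable_curve (label \<gamma> v)) \<and>
    finite \<S> \<and> partition_on (UNIV - N) \<S> \<and>
    (\<forall>S\<in>\<S>. forward_complete S \<and> maximal_stable_subtree \<gamma> S)"
proof (intro exI conjI)
  \<comment> \<open>The exceptional set is the set of all unstable vertices, and the parts are the
    full subtrees below the minimal stable ones.\<close>
  let ?S = "descendants ` stable_roots \<gamma>"
  show "finite (unstable \<gamma>)" using assms by (rule finite_unstable)
  then show "finite ?S" by (intro finite_imageI finite_stable_roots)
  show "\<forall>v\<in>unstable \<gamma>. \<not> stable_curve (label \<gamma> v)" by (simp add: unstable_def)
  show "\<forall>S\<in>?S. forward_complete S \<and> maximal_stable_subtree \<gamma> S"
    using forward_complete_descendants maximal_descendants by blast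
  show "partition_on (UNIV - unstable \<gamma>) ?S"
  proof (rule partition_onI)
    show "\<Union> ?S = UNIV - unstable \<gamma>"
      using stable_root_exists descendants_stable by fast
    show "{} \<notin> ?S"
      by (auto simp: descendants_def)
    show "disjnt p q" if "p \<in> ?S" "q \<in> ?S" "p \<noteq> q" for p q
      using that disjoint_stable_roots unfolding disjnt_def by blast
  qed
qed

end
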